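(* Let $(p_{ij} \colon X_j \to X_i)_{i \sqsubseteq j \in I}$ be a projective system of topological spaces, with canonical projective limit $X, (p_i)_{i \in I}$. If: 1. the projective system is an ep-system, 2. or every $X_i$ is sober and every $p_{ij}$ is a proper map, 3. or $I$ has a countable cofinal subset and each $X_i$ is locally compact sober, then $(\mathcal H_{\mathsf V}\, p_{ij} \colon \mathcal H_{\mathsf V} X_j \to \mathcal H_{\mathsf V} X_i)_{i \sqsubseteq j \in I}$ is a projective system of topological spaces, and $\mathcal H_{\mathsf V} X, (\mathcal H_{\mathsf V}\, p_i)_{i \in I}$ is its projective limit, up to homeomorphism. The same holds with $\mathcal H_{0\mathsf V}$ in lieu of $\mathcal H_{\mathsf V}$.
   Context: **Topology.** The specialization preordering is: $x \leq y$ iff every open neighborhood of $x$ contains $y$; $\downarrow A$ denotes downward closure. A subset is saturated iff it is upwards-closed. Compactness is the open cover property, with no separation axiom. A space is locally compact iff every point has a base of compact neighborhoods, and sober iff it is $T_0$ and every irreducible closed subset is the closure of a point. A continuous map $f \colon X \to Y$ is proper iff $\downarrow f[F]$ is closed for every closed $F \subseteq X$ and $f^{-1}(Q)$ is compact saturated for every compact saturated $Q \subseteq Y$. **Projective systems.** A projective system $(p_{ij} \colon X_j \to X_i)_{i \sqsubseteq j \in I}$ consists of a directed preordered set $(I,\sqsubseteq)$, spaces $X_i$, and continuous maps $p_{ij}$ ($i \sqsubseteq j$) with $p_{ii} = \mathrm{id}$ and $p_{ij} \circ p_{jk} = p_{ik}$ for $i \sqsubseteq j \sqsubseteq k$. Its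 canonical projective limit is $X = \{\vec x \in \prod_{i} X_i \mid p_{ij}(x_j) = x_i \text{ for all } i \sqsubseteq j\}$ with the subspace topology of the product, $p_i$ being projection onto coordinate $i$. Saying that $Y, (q_i)_{i\in I}$ is the projective limit up to homeomorphism of a projective system with canonical limit $Z$ means that the map $y \mapsto (q_i(y))_{i \in I}$ is a (well-defined) homeomorphism from $Y$ onto $Z$. The projective system is an ep-system iff there are continuous maps $e_{ij} \colon X_i \to X_j$ ($i \sqsubseteq j$) with $p_{ij} \circ e_{ij} = \mathrm{id}_{X_i}$, $e_{ij} \circ p_{ij} \leq \mathrm{id}_{X_j}$ (pointwise, in the specialization preordering of $X_j$), $e_{ii} = \mathrm{id}$, and $e_{jk} \circ e_{ij} = e_{ik}$. **Hoare hyperspaces.** $\mathcal H_{0\mathsf V} X$ (resp. $\mathcal H_{\mathsf V} X$) is the set of all closed subsets of $X$ (resp., all non-empty ones) with the lower Vietoris topology, generated by the subbasic open sets $\Diamond U = \{C \mid C \cap U \neq \emptyset\}$, for $U$ open in $X$. Both are endofunctors on the category of topological spaces, a continuous map $f \colon X \to Y$ acting by $C \mapsto cl(f[C])$, the closure of the image. *)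

theory Defs
  imports "HOL-Analysis.Analysis"
begin

definition spec_le :: "'a topology \<Rightarrow> 'a \<Rightarrow> 'a \<Rightarrow> bool" where
  "spec_le X x y \<longleftrightarrow> x \<in> topspace X \<and> y \<in> topspace X \<and> (\<forall>U. openin X U \<and> x \<in> U \<longrightarrow> y \<in> U)"

definition down_closure :: "'a topology \<Rightarrow> 'a set \<Rightarrow> 'a set" where
  "down_closure X A = {x. \<exists>a\<in>A. spec_le X x a}"

definition saturated_in :: "'a topology \<Rightarrow> 'a set \<Rightarrow> bool" where
  "saturated_in X Q \<longleftrightarrow> Q \<subseteq> topspace X \<and> (\<forall>x\<in>Q. \<forall>y. spec_le X x y \<longrightarrow> y \<in> Q)"

definition irreducible_closedin :: "'a topology \<Rightarrow> 'a set \<Rightarrow> bool" where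
  "irreducible_closedin X C \<longleftrightarrow> closedin X C \<and> C \<noteq> {} \<and>
     (\<forall>C1 C2. closedin X C1 \<and> closedin X C2 \<and> C \<subseteq> C1 \<union> C2 \<longrightarrow> C \<subseteq> C1 \<or> C \<subseteq> C2)"

definition sober_space :: "'a topology \<Rightarrow> bool" where
  "sober_space X \<longleftrightarrow> t0_space X \<and>
     (\<forall>C. irreducible_closedin X C \<longrightarrow> (\<exists>x\<in>topspace X. C = X closure_of {x}))"

text \<open>The library's \<open>locally_compact_space\<close> only asks for one compact neighborhood of each
  point, which is strictly weaker for non-Hausdorff spaces.\<close>

definition base_locally_compact_space :: "'a topology \<Rightarrow> bool" where
  "base_locally_compact_space X \<longleftrightarrow> neighbourhood_base_of (compactin X) X"

text \<open>This is not the library's \<open>proper_map\<close>, which requires the image of every closed set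
  itself to be closed, and fibers of points to be compact.\<close>

definition saturated_proper_map :: "'a topology \<Rightarrow> 'b topology \<Rightarrow> ('a \<Rightarrow> 'b) \<Rightarrow> bool" where
  "saturated_proper_map X Y f \<longleftrightarrow> continuous_map X Y f \<and>
     (\<forall>F. closedin X F \<longrightarrow> closedin Y (down_closure Y (f ` F))) \<and>
     (\<forall>Q. compactin Y Q \<and> saturated_in Y Q \<longrightarrow>
        compactin X {x \<in> topspace X. f x \<in> Q} \<and> saturated_in X {x \<in> topspace X. f x \<in> Q})"

definition directed_preorder :: "'i set \<Rightarrow> ('i \<Rightarrow> 'i \<Rightarrow> bool) \<Rightarrow> bool" where
  "directed_preorder I le \<longleftrightarrow> reflp_on I le \<and> transp_on I le \<and> I \<noteq> {} \<and>
     (\<forall>i\<in>I. \<forall>j\<in>I. \<exists>k\<in>I. le i k \<and> le j k)"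

text \<open>Below, \<open>p i j\<close> is the bonding map from \<open>X j\<close> to \<open>X i\<close>, and \<open>e i j\<close> goes from
  \<open>X i\<close> to \<open>X j\<close>, for \<open>i\<close> below \<open>j\<close>. Values of \<open>le\<close>, \<open>X\<close>, \<open>p\<close>, \<open>e\<close> elsewhere are irrelevant.\<close>

definition projective_system ::
    "'i set \<Rightarrow> ('i \<Rightarrow> 'i \<Rightarrow> bool) \<Rightarrow> ('i \<Rightarrow> 'a topology) \<Rightarrow> ('i \<Rightarrow> 'i \<Rightarrow> 'a \<Rightarrow> 'a) \<Rightarrow> bool" where
  "projective_system I le X p \<longleftrightarrow> directed_preorder I le \<and>
     (\<forall>i\<in>I. \<forall>j\<in>I. le i j \<longrightarrow> continuous_map (X j) (X i) (p i j)) \<and>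
     (\<forall>i\<in>I. \<forall>x\<in>topspace (X i). p i i x = x) \<and>
     (\<forall>i\<in>I. \<forall>j\<in>I. \<forall>k\<in>I. le i j \<and> le j k \<longrightarrow>
        (\<forall>x\<in>topspace (X k). p i j (p j k x) = p i k x))"

definition ep_system ::
    "'i set \<Rightarrow> ('i \<Rightarrow> 'i \<Rightarrow> bool) \<Rightarrow> ('i \<Rightarrow> 'a topology) \<Rightarrow> ('i \<Rightarrow> 'i \<Rightarrow> 'a \<Rightarrow> 'a) \<Rightarrow> bool" where
  "ep_system I le X p \<longleftrightarrow> projective_system I le X p \<and>
     (\<exists>e :: 'i \<Rightarrow> 'i \<Rightarrow> 'a \<Rightarrow> 'a.
       (\<forall>i\<in>I. \<forall>j\<in>I. le i j \<longrightarrow> continuous_map (X i) (X j) (e i j) \<and>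
          (\<forall>x\<in>topspace (X i). p i j (e i j x) = x) \<and>
          (\<forall>x\<in>topspace (X j). spec_le (X j) (e i j (p i j x)) x)) \<and>
       (\<forall>i\<in>I. \<forall>x\<in>topspace (X i). e i i x = x) \<and>
       (\<forall>i\<in>I. \<forall>j\<in>I. \<forall>k\<in>I. le i j \<and> le j k \<longrightarrow>
          (\<forall>x\<in>topspace (X i). e j k (e i j x) = e i k x)))"

definition has_countable_cofinal :: "'i set \<Rightarrow> ('i \<Rightarrow> 'i \<Rightarrow> bool) \<Rightarrow> bool" where
  "has_countable_cofinal I le \<longleftrightarrow> (\<exists>J\<subseteq>I. countable J \<and> (\<forall>i\<in>I. \<exists>j\<in>J. le i j))"

definition projective_limit ::
    "'i set \<Rightarrow> ('i \<Rightarrow> 'i \<Rightarrow> bool) \<Rightarrow> ('i \<Rightarrow> 'a topology) \<Rightarrow> ('i \<Rightarrow> 'i \<Rightarrow> 'a \<Rightarrow> 'a) \<Rightarrow> ('i \<Rightarrow> 'a) topology" where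
  "projective_limit I le X p = subtopology (product_topology X I)
     {x \<in> (\<Pi>\<^sub>E i\<in>I. topspace (X i)). \<forall>i\<in>I. \<forall>j\<in>I. le i j \<longrightarrow> p i j (x j) = x i}"

definition is_projective_limit ::
    "'i set \<Rightarrow> ('i \<Rightarrow> 'i \<Rightarrow> bool) \<Rightarrow> ('i \<Rightarrow> 'a topology) \<Rightarrow> ('i \<Rightarrow> 'i \<Rightarrow> 'a \<Rightarrow> 'a) \<Rightarrow>
     'b topology \<Rightarrow> ('i \<Rightarrow> 'b \<Rightarrow> 'a) \<Rightarrow> bool" where
  "is_projective_limit I le X p Y q \<longleftrightarrow>
     homeomorphic_map Y (projective_limit I le X p) (\<lambda>y. \<lambda>i\<in>I. q i y)"

text \<open>The carrier \<open>\<C>\<close> itself is inserted as a generator because the space of a generated topology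
  is the union of its generators, and no set \<open>\<diamond>U\<close> contains the empty closed set.\<close>

definition lower_vietoris_on :: "'a set set \<Rightarrow> 'a topology \<Rightarrow> 'a set topology" where
  "lower_vietoris_on \<C> X =
     topology_generated_by (insert \<C> {{C \<in> \<C>. C \<inter> U \<noteq> {}} | U. openin X U})"

definition hoare0_space :: "'a topology \<Rightarrow> 'a set topology" where
  "hoare0_space X = lower_vietoris_on {C. closedin X C} X"

definition hoare_space :: "'a topology \<Rightarrow> 'a set topology" where
  "hoare_space X = lower_vietoris_on {C. closedin X C \<and> C \<noteq> {}} X"

text \<open>The functorial action on a map into \<open>Y\<close>, the same for both hyperspaces.\<close>

definition hoare_map :: "'b topology \<Rightarrow> ('a \<Rightarrow> 'b) \<Rightarrow> 'a set \<Rightarrow> 'b set" where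
  "hoare_map Y f C = Y closure_of (f ` C)"

lemma topspace_lower_vietoris_on [simp]: "topspace (lower_vietoris_on \<C> X) = \<C>"
  unfolding lower_vietoris_on_def by auto

lemma topspace_hoare0_space [simp]: "topspace (hoare0_space X) = {C. closedin X C}"
  by (simp add: hoare0_space_def)

lemma topspace_hoare_space [simp]: "topspace (hoare_space X) = {C. closedin X C \<and> C \<noteq> {}}"
  by (simp add: hoare_space_def)

end

theory Submission
  imports Defs
begin

text \<open>
  Let \<open>L\<close> be the limit of the spaces \<open>X i\<close>. A point of the limit of the hyperspaces is a family of closed
  sets \<open>C i\<close> in which \<open>C i\<close> is the closure of the image of \<open>C j\<close> whenever \<open>i\<close> is below \<open>j\<close>. The only
  candidate for a closed subset of \<open>L\<close> inducing such a family is the set \<open>threads_in C\<close> of all points of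
  \<open>L\<close> with every coordinate in the corresponding \<open>C i\<close>. Since the index set is directed, the open sets
  that constrain a single coordinate form a base of \<open>L\<close> (\<open>projective_limit_basis\<close>). Hence a closed
  subset of \<open>L\<close> is recovered from the closures of its projections, whatever the system
  (\<open>threads_in_hoare_map_eq\<close>). The comparison map is continuous by functoriality of the hyperspaces.

  What depends on the hypotheses is whether the family is recovered from its threads, that is, whether
  every open set that meets \<open>C i\<close> contains the \<open>i\<close>-th coordinate of some thread in the family. This is
  \<open>has_dense_threads\<close>; it gives both surjectivity of the comparison map and continuity of its inverse,
  because it says that \<open>threads_in C\<close> meets the basic open set over \<open>U\<close> exactly if \<open>C i\<close> meets \<open>U\<close>
  (\<open>is_projective_limit_hyperspace\<close>).

  For an ep-system, a point \<open>z\<close> of \<open>C i\<close> extends to the thread of its images under the embeddings. These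
  stay in the family: closed sets are downward closed, so projecting \<open>C j\<close> to \<open>X i\<close> and embedding it back
  into \<open>X j\<close> stays inside \<open>C j\<close>; by continuity the embedding sends \<open>C i\<close>, the closure of that
  projection, into \<open>C j\<close>.

  The other two cases rest on a variant of Steenrod's theorem (\<open>compact_sober_thread\<close>): in a projective
  system of sober spaces, if compact sets \<open>Q i\<close> and closed sets \<open>C i\<close> that meet them are both
  preserved by the bonding maps, there is a thread in the \<open>C i\<close> whose coordinates lie in every open
  neighborhood of the \<open>Q i\<close>. By Zorn's lemma the \<open>C i\<close> contain a minimal family of the same kind;
  minimality makes its members irreducible, and their generic points form the thread. With proper maps,
  \<open>Q j\<close> is the preimage of the set of all points above a point \<open>z\<close> of \<open>C i\<close> in the open set. With locally
  compact spaces and a countable cofinal set, the \<open>Q n\<close> are chosen one after the other along a cofinal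
  sequence, each inside the preimage of an open part of the preceding one that still meets the family.
\<close>

section \<open>Specialization, sobriety and compactness\<close>

lemma spec_le_in_closed:
  assumes "closedin X C" "spec_le X x y" "y \<in> C"
  shows "x \<in> C"
proof (rule ccontr)
  assume "x \<notin> C"
  then have "x \<in> topspace X - C" "openin X (topspace X - C)"
    using assms by (auto simp: spec_le_def)
  then show False
    using assms by (auto simp: spec_le_def)
qed

lemma spec_le_refl: "x \<in> topspace X \<Longrightarrow> spec_le X x x"
  by (simp add: spec_le_def)

lemma sober_space_generic_point_unique:
  assumes "sober_space X" "x \<in> topspace X" "y \<in> topspace X" "X closure_of {x} = X closure_of {y}"
  shows "x = y"
  using assms unfolding sober_space_def t0_space_closure_of_sing by blast

text \<open>An open set that contains \<open>x\<close> contains everything above \<open>x\<close>, so one member of any cover suffices.\<close>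

lemma compactin_up_closure_of_point:
  assumes "x \<in> topspace X"
  shows "compactin X {y. spec_le X x y}"
  unfolding compactin_def
proof (intro conjI allI impI)
  show "{y. spec_le X x y} \<subseteq> topspace X"
    by (auto simp: spec_le_def)
next
  fix \<U> assume \<U>: "Ball \<U> (openin X) \<and> {y. spec_le X x y} \<subseteq> \<Union> \<U>"
  then obtain U where U: "U \<in> \<U>" "x \<in> U"
    using spec_le_refl[OF assms] by blast
  then have "{y. spec_le X x y} \<subseteq> U"
    using \<U> by (auto simp: spec_le_def)
  then show "\<exists>\<F>. finite \<F> \<and> \<F> \<subseteq> \<U> \<and> {y. spec_le X x y} \<subseteq> \<Union> \<F>"
    using U by (intro exI[of _ "{U}"]) auto
qed

lemma saturated_in_up_closure_of_point: "saturated_in X {y. spec_le X x y}"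
  by (auto simp: saturated_in_def spec_le_def)

text \<open>The finite intersection property, in the form in which compactness is used below: by filteredness
  each finite subfamily has a lower bound in the family, and that lower bound meets \<open>Q\<close>.\<close>

lemma compactin_meets_filtered_Inter:
  assumes Q: "compactin X Q" and ne: "\<F> \<noteq> {}"
    and closed: "\<And>F. F \<in> \<F> \<Longrightarrow> closedin X F"
    and meets: "\<And>F. F \<in> \<F> \<Longrightarrow> F \<inter> Q \<noteq> {}"
    and filtered: "\<And>F G. F \<in> \<F> \<Longrightarrow> G \<in> \<F> \<Longrightarrow> \<exists>H\<in>\<F>. H \<subseteq> F \<inter> G"
  shows "\<Inter>\<F> \<inter> Q \<noteq> {}"
proof -
  have below: "\<exists>H\<in>\<F>. H \<subseteq> \<Inter>\<G>" if "finite \<G>" "\<G> \<subseteq> \<F>" for \<G>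
    using that
  proof (induction \<G>)
    case empty
    then show ?case using ne by auto
  next
    case (insert F \<G>)
    then obtain H where H: "H \<in> \<F>" "H \<subseteq> \<Inter>\<G>" by auto
    have "F \<in> \<F>" using insert.prems by simp
    from filtered[OF this H(1)] H(2) show ?case by (simp add: le_infI2) (meson order_trans)
  qed
  have "Q \<inter> \<Inter>\<G> \<noteq> {}" if fin: "finite \<G> \<and> \<G> \<subseteq> \<F>" for \<G>
  proof -
    obtain H where H: "H \<in> \<F>" "H \<subseteq> \<Inter>\<G>" using below fin by meson
    then show ?thesis using meets[OF H(1)] by blast
  qed
  then have "Q \<inter> \<Inter>\<F> \<noteq> {}"
    using Q closed unfolding compactin_fip by simp
  then show ?thesis by (simp add: Int_commute)
qed

section \<open>Threads\<close>

lemma directed_preorder_rules: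
  assumes "directed_preorder I le"
  shows directed_preorder_refl: "\<And>i. i \<in> I \<Longrightarrow> le i i"
    and directed_preorder_trans:
      "\<And>i j k. i \<in> I \<Longrightarrow> j \<in> I \<Longrightarrow> k \<in> I \<Longrightarrow> le i j \<Longrightarrow> le j k \<Longrightarrow> le i k"
    and directed_preorder_upper: "\<And>i j. i \<in> I \<Longrightarrow> j \<in> I \<Longrightarrow> \<exists>k\<in>I. le i k \<and> le j k"
    and directed_preorder_nonempty: "I \<noteq> {}"
  using assms unfolding directed_preorder_def
  by (auto dest: reflp_onD transp_onD)

lemma directed_preorder_finite_upper:
  assumes "directed_preorder I le" "finite A" "A \<subseteq> I"
  shows "\<exists>k\<in>I. \<forall>i\<in>A. le i k"
  using assms(2,3)
proof (induction A)
  case empty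
  then show ?case using directed_preorder_nonempty[OF assms(1)] by auto
next
  case (insert a A)
  then obtain k where k: "k \<in> I" "\<forall>i\<in>A. le i k" by auto
  then obtain m where "m \<in> I" "le a m" "le k m"
    using directed_preorder_upper[OF assms(1), of a k] insert.prems by auto
  then show ?case
    using k insert.prems directed_preorder_trans[OF assms(1)] by (metis insert_iff subsetD)
qed

text \<open>Only the indices above a given \<open>i\<close> have a bonding map to \<open>X i\<close>; restricting to them loses nothing, as
  they are cofinal.\<close>

lemma directed_preorder_above:
  assumes dir: "directed_preorder I le" and "i \<in> I"
  shows "directed_preorder {j \<in> I. le i j} le"
proof -
  have "\<exists>k\<in>{j \<in> I. le i j}. le a k \<and> le b k" if "a \<in> {j \<in> I. le i j}" "b \<in> {j \<in> I. le i j}" for a b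
    using that directed_preorder_upper[OF dir, of a b] directed_preorder_trans[OF dir, of i a] \<open>i \<in> I\<close>
    by blast
  moreover have "reflp_on {j \<in> I. le i j} le" "transp_on {j \<in> I. le i j} le"
    using dir unfolding directed_preorder_def
    by (auto intro: reflp_on_subset transp_on_subset)
  ultimately show ?thesis
    using directed_preorder_refl[OF dir \<open>i \<in> I\<close>] \<open>i \<in> I\<close> unfolding directed_preorder_def
    by blast
qed

lemma projective_system_rules:
  assumes "projective_system I le X p"
  shows projective_system_directed: "directed_preorder I le"
    and projective_system_continuous:
      "\<And>i j. i \<in> I \<Longrightarrow> j \<in> I \<Longrightarrow> le i j \<Longrightarrow> continuous_map (X j) (X i) (p i j)"
    and projective_system_topspace:
      "\<And>i j x. i \<in> I \<Longrightarrow> j \<in> I \<Longrightarrow> le i j \<Longrightarrow> x \<in> topspace (X j) \<Longrightarrow> p i j x \<in> topspace (X i)"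
    and projective_system_id: "\<And>i x. i \<in> I \<Longrightarrow> x \<in> topspace (X i) \<Longrightarrow> p i i x = x"
    and projective_system_comp:
      "\<And>i j k x. i \<in> I \<Longrightarrow> j \<in> I \<Longrightarrow> k \<in> I \<Longrightarrow> le i j \<Longrightarrow> le j k \<Longrightarrow> x \<in> topspace (X k) \<Longrightarrow>
         p i j (p j k x) = p i k x"
  using assms unfolding projective_system_def
  by (auto dest: continuous_map_funspace)

lemma projective_system_image_comp:
  assumes ps: "projective_system I le X p" and "i \<in> I" "j \<in> I" "k \<in> I" "le i j" "le j k"
    and "S \<subseteq> topspace (X k)"
  shows "p i j ` p j k ` S = p i k ` S"
  unfolding image_image
  by (rule image_cong[OF refl]) (use assms projective_system_comp[OF ps] in blast)

lemma topspace_projective_limit: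
  "topspace (projective_limit I le X p) =
     {x \<in> (\<Pi>\<^sub>E i\<in>I. topspace (X i)). \<forall>i\<in>I. \<forall>j\<in>I. le i j \<longrightarrow> p i j (x j) = x i}"
  by (auto simp: projective_limit_def)

lemma continuous_map_projective_limit_proj:
  "i \<in> I \<Longrightarrow> continuous_map (projective_limit I le X p) (X i) (\<lambda>x. x i)"
  unfolding projective_limit_def
  by (intro continuous_map_from_subtopology continuous_map_product_projection)

text \<open>A basic neighborhood in the product constrains finitely many coordinates. All of them are
  images of one common upper coordinate, so a single coordinate determines the neighborhood.\<close>

lemma projective_limit_basis:
  assumes ps: "projective_system I le X p"
    and V: "openin (projective_limit I le X p) V" and x: "x \<in> V"
  obtains i U where "i \<in> I" "openin (X i) U" "x i \<in> U"
    "\<And>y. y \<in> topspace (projective_limit I le X p) \<Longrightarrow> y i \<in> U \<Longrightarrow> y \<in> V"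
proof -
  let ?L = "projective_limit I le X p"
  have thread: "p i j (y j) = y i"
    if "y \<in> topspace ?L" "i \<in> I" "j \<in> I" "le i j" for y i j
    using that unfolding topspace_projective_limit by blast
  have xL: "x \<in> topspace ?L"
    using V x openin_subset by blast
  obtain T where T: "openin (product_topology X I) T" "V = T \<inter> topspace ?L"
    using V unfolding topspace_projective_limit unfolding projective_limit_def openin_subtopology
    by (elim exE conjE)
  then obtain W where W: "finite {i \<in> I. W i \<noteq> topspace (X i)}" "\<And>i. i \<in> I \<Longrightarrow> openin (X i) (W i)"
      "x \<in> Pi\<^sub>E I W" "Pi\<^sub>E I W \<subseteq> T"
    using x unfolding openin_product_topology_alt by (metis IntD1)
  let ?A = "{i \<in> I. W i \<noteq> topspace (X i)}"
  obtain k where k: "k \<in> I" "\<And>i. i \<in> ?A \<Longrightarrow> le i k"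
    using directed_preorder_finite_upper[OF projective_system_directed[OF ps] W(1)] by blast
  define U where "U = topspace (X k) \<inter> (\<Inter>i\<in>?A. {z \<in> topspace (X k). p i k z \<in> W i})"
  have "openin (X k) U"
  proof (cases "?A = {}")
    case False
    have "openin (X k) {z \<in> topspace (X k). p i k z \<in> W i}" if "i \<in> ?A" for i
      using that W(2) k
      by (intro openin_continuous_map_preimage[OF projective_system_continuous[OF ps]]) auto
    then show ?thesis
      unfolding U_def using W(1) False by (intro openin_Int openin_topspace openin_Inter) auto
  next
    case True
    show ?thesis unfolding U_def True by simp
  qed
  moreover have "x k \<in> U"
  proof -
    have "x k \<in> topspace (X k)"
      using xL k(1) unfolding topspace_projective_limit by blast
    moreover have "p i k (x k) \<in> W i" if "i \<in> ?A" for i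
      using thread[OF xL _ k(1) k(2)[OF that]] PiE_mem[OF W(3)] that by simp
    ultimately show ?thesis unfolding U_def by simp
  qed
  moreover have "y \<in> V" if y: "y \<in> topspace ?L" "y k \<in> U" for y
  proof -
    have yP: "y \<in> (\<Pi>\<^sub>E i\<in>I. topspace (X i))"
      using y(1) by (simp add: topspace_projective_limit)
    have "y i \<in> W i" if "i \<in> I" for i
    proof (cases "i \<in> ?A")
      case True
      then have "p i k (y k) \<in> W i" using y(2) unfolding U_def by blast
      then show ?thesis using thread[OF y(1) that k(1) k(2)[OF True]] by simp
    next
      case False
      then show ?thesis using PiE_mem[OF yP that] that by simp
    qed
    then have "y \<in> Pi\<^sub>E I W"
      using yP by (simp add: PiE_iff)
    then show ?thesis using W(4) T y(1) by blast
  qed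
  ultimately show ?thesis using that k by blast
qed

text \<open>A thread over a cofinal reindexing determines the thread over all of \<open>I\<close>: its coordinate at \<open>i\<close> is
  the image of any given coordinate beyond \<open>i\<close>, and directedness makes the choice immaterial. The map \<open>s\<close>
  may identify indices, so that a cofinal sequence is allowed to repeat itself.\<close>

lemma extend_thread:
  assumes ps: "projective_system I le X p" and dirJ: "directed_preorder J leJ"
    and s: "\<And>j. j \<in> J \<Longrightarrow> s j \<in> I"
    and mono: "\<And>j k. j \<in> J \<Longrightarrow> k \<in> J \<Longrightarrow> leJ j k \<Longrightarrow> le (s j) (s k)"
    and cofinal: "\<And>i. i \<in> I \<Longrightarrow> \<exists>j\<in>J. le i (s j)"
    and x: "\<And>j. j \<in> J \<Longrightarrow> x j \<in> topspace (X (s j))"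
    and thread: "\<And>j k. j \<in> J \<Longrightarrow> k \<in> J \<Longrightarrow> leJ j k \<Longrightarrow> p (s j) (s k) (x k) = x j"
  obtains y where "y \<in> topspace (projective_limit I le X p)" "\<And>j. j \<in> J \<Longrightarrow> y (s j) = x j"
proof -
  note dirI = projective_system_directed[OF ps]
  obtain c where c: "\<And>i. i \<in> I \<Longrightarrow> c i \<in> J \<and> le i (s (c i))"
    using cofinal by metis
  define y where "y = (\<lambda>i\<in>I. p i (s (c i)) (x (c i)))"
  have indep: "y i = p i (s j) (x j)" if ij: "i \<in> I" "j \<in> J" "le i (s j)" for i j
  proof -
    obtain k where k: "k \<in> J" "leJ j k" "leJ (c i) k"
      using directed_preorder_upper[OF dirJ, of j "c i"] ij(2) c[OF ij(1)] by blast
    have "p i (s j) (x j) = p i (s k) (x k)"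
      using projective_system_comp[OF ps, of i "s j" "s k" "x k"] thread[of j k] that k s mono x
      by metis
    moreover have "p i (s (c i)) (x (c i)) = p i (s k) (x k)"
      using projective_system_comp[OF ps, of i "s (c i)" "s k" "x k"] thread[of "c i" k] that k s mono x c
      by metis
    ultimately show ?thesis using that by (simp add: y_def)
  qed
  have "p i j (y j) = y i" if "i \<in> I" "j \<in> I" "le i j" for i j
  proof -
    have "le i (s (c j))"
      using directed_preorder_trans[OF dirI, of i j "s (c j)"] that c s by blast
    then have "y i = p i (s (c j)) (x (c j))"
      using indep that c by blast
    then show ?thesis
      using projective_system_comp[OF ps, of i j "s (c j)" "x (c j)"] that c s x indep[of j "c j"] by simp
  qed
  moreover have "y i \<in> topspace (X i)" if "i \<in> I" for i
    using that projective_system_topspace[OF ps] c s x by (simp add: y_def)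
  ultimately have "y \<in> topspace (projective_limit I le X p)"
    by (auto simp: topspace_projective_limit y_def)
  moreover have "y (s j) = x j" if "j \<in> J" for j
    using indep[of "s j" j] that s x projective_system_id[OF ps] directed_preorder_refl[OF dirI] by simp
  ultimately show ?thesis using that by blast
qed

section \<open>Threads through compact sets in sober spaces\<close>

text \<open>The families to which Zorn's lemma is applied. The sets \<open>F i\<close> form a subsystem of closed sets; meeting
  the compact set \<open>Q i\<close> is the form of non-emptiness that survives intersections of chains.\<close>

definition closed_subsystem ::
    "'i set \<Rightarrow> ('i \<Rightarrow> 'i \<Rightarrow> bool) \<Rightarrow> ('i \<Rightarrow> 'a topology) \<Rightarrow> ('i \<Rightarrow> 'i \<Rightarrow> 'a \<Rightarrow> 'a) \<Rightarrow>
     ('i \<Rightarrow> 'a set) \<Rightarrow> ('i \<Rightarrow> 'a set) \<Rightarrow> bool" where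
  "closed_subsystem I le X p Q F \<longleftrightarrow>
     (\<forall>i\<in>I. closedin (X i) (F i) \<and> F i \<inter> Q i \<noteq> {}) \<and>
     (\<forall>i\<in>I. \<forall>j\<in>I. le i j \<longrightarrow> p i j ` F j \<subseteq> F i)"

lemma closed_subsystem_rules:
  assumes "closed_subsystem I le X p Q F"
  shows closed_subsystem_closedin: "\<And>i. i \<in> I \<Longrightarrow> closedin (X i) (F i)"
    and closed_subsystem_topspace: "\<And>i. i \<in> I \<Longrightarrow> F i \<subseteq> topspace (X i)"
    and closed_subsystem_meets: "\<And>i. i \<in> I \<Longrightarrow> F i \<inter> Q i \<noteq> {}"
    and closed_subsystem_image: "\<And>i j. i \<in> I \<Longrightarrow> j \<in> I \<Longrightarrow> le i j \<Longrightarrow> p i j ` F j \<subseteq> F i"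
  using assms unfolding closed_subsystem_def by (simp_all add: closedin_subset)

text \<open>Intersections of chains are again closed subsystems, by compactness of the \<open>Q i\<close>; hence Zorn.\<close>

lemma minimal_closed_subsystem:
  assumes Q: "\<And>i. i \<in> I \<Longrightarrow> compactin (X i) (Q i)" and C: "closed_subsystem I le X p Q C"
  obtains F where "closed_subsystem I le X p Q F" "F \<le> C"
    "\<And>G. closed_subsystem I le X p Q G \<Longrightarrow> G \<le> F \<Longrightarrow> G = F"
proof -
  let ?S = "{F. closed_subsystem I le X p Q F \<and> F \<le> C}"
  let ?R = "relation_of (\<lambda>F G. G \<le> F) ?S"
  have "\<exists>F\<in>?S. \<forall>G\<in>?S. G \<le> F \<longrightarrow> G = F"
  proof (rule predicate_Zorn)
    show "partial_order_on ?S ?R"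
      by (rule partial_order_on_relation_ofI) auto
  next
    fix K assume K: "K \<in> Chains ?R"
    have KS: "F \<in> ?S" if "F \<in> K" for F
      using Chains_relation_of[OF K] that by blast
    have chain: "F \<le> G \<or> G \<le> F" if "F \<in> K" "G \<in> K" for F G
      using K that unfolding Chains_def relation_of_def by auto
    show "\<exists>M\<in>?S. \<forall>F\<in>K. M \<le> F"
    proof (cases "K = {}")
      case True
      then show ?thesis using C by auto
    next
      case False
      define M where "M = (\<lambda>i. \<Inter>F\<in>K. F i)"
      have below: "M \<le> F" if "F \<in> K" for F
        using that by (auto simp: M_def le_fun_def)
      have "M i \<inter> Q i \<noteq> {}" if "i \<in> I" for i
        unfolding M_def
      proof (rule compactin_meets_filtered_Inter[OF Q[OF that]])
        show "(\<lambda>F. F i) ` K \<noteq> {}" using False by simp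
        show "closedin (X i) A" "A \<inter> Q i \<noteq> {}" if "A \<in> (\<lambda>F. F i) ` K" for A
          using that KS \<open>i \<in> I\<close> unfolding closed_subsystem_def by auto
        show "\<exists>H\<in>(\<lambda>F. F i) ` K. H \<subseteq> A \<inter> B"
          if AB: "A \<in> (\<lambda>F. F i) ` K" "B \<in> (\<lambda>F. F i) ` K" for A B
        proof -
          obtain F G where FG: "F \<in> K" "A = F i" "G \<in> K" "B = G i" using AB by blast
          then show ?thesis
            using chain[of F G] by (auto simp: le_fun_def)
        qed
      qed
      moreover have "closedin (X i) (M i)" if "i \<in> I" for i
        unfolding M_def using False KS that
        by (intro closedin_Inter) (auto simp: closed_subsystem_def)
      moreover have "p i j ` M j \<subseteq> M i" if "i \<in> I" "j \<in> I" "le i j" for i j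
      proof -
        have "p i j ` F j \<subseteq> F i" if "F \<in> K" for F
          using KS[OF that] \<open>i \<in> I\<close> \<open>j \<in> I\<close> \<open>le i j\<close> by (simp add: closed_subsystem_def)
        then show ?thesis unfolding M_def by blast
      qed
      moreover have "M \<le> C"
      proof -
        obtain F where "F \<in> K" using False by blast
        then show ?thesis using order_trans[OF below[of F], of C] KS[of F] by simp
      qed
      ultimately have "M \<in> ?S" by (simp add: closed_subsystem_def)
      then show ?thesis using below by blast
    qed
  qed
  then obtain F where F: "F \<in> ?S" "\<forall>G\<in>?S. G \<le> F \<longrightarrow> G = F" by blast
  have minimal: "G = F" if "closed_subsystem I le X p Q G" "G \<le> F" for G
    using F that order_trans[of G F C] by simp
  show ?thesis
  proof (rule that)
    show "closed_subsystem I le X p Q F" using F(1) by simp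
    show "F \<le> C" using F(1) by simp
    show "G = F" if "closed_subsystem I le X p Q G" "G \<le> F" for G
      using minimal[OF that] .
  qed
qed

text \<open>Replacing each \<open>F i\<close> by the intersection, over \<open>j\<close> above \<open>i\<close>, of the closures of the images of
  \<open>F j\<close> yields a smaller closed subsystem, so by minimality nothing changes.\<close>

lemma minimal_closed_subsystem_dense:
  assumes ps: "projective_system I le X p"
    and Q: "\<And>i. i \<in> I \<Longrightarrow> compactin (X i) (Q i)"
    and pQ: "\<And>i j. i \<in> I \<Longrightarrow> j \<in> I \<Longrightarrow> le i j \<Longrightarrow> p i j ` Q j \<subseteq> Q i"
    and F: "closed_subsystem I le X p Q F"
    and minimal: "\<And>G. closed_subsystem I le X p Q G \<Longrightarrow> G \<le> F \<Longrightarrow> G = F"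
    and ij: "i \<in> I" "j \<in> I" "le i j"
  shows "X i closure_of (p i j ` F j) = F i"
proof -
  note dir = projective_system_directed[OF ps]
  note Fclosed = closed_subsystem_closedin[OF F] and Fsub = closed_subsystem_topspace[OF F]
    and FQ = closed_subsystem_meets[OF F] and pF = closed_subsystem_image[OF F]
  define G where "G = (\<lambda>i. if i \<in> I then \<Inter>j\<in>{j\<in>I. le i j}. X i closure_of (p i j ` F j) else F i)"
  have smaller: "X i closure_of (p i k ` F k) \<subseteq> X i closure_of (p i j ` F j)"
    if "i \<in> I" "j \<in> I" "k \<in> I" "le i j" "le j k" for i j k
  proof -
    have "p i k ` F k = p i j ` (p j k ` F k)"
      using projective_system_image_comp[OF ps that Fsub] that by simp
    moreover have "p j k ` F k \<subseteq> F j"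
      using pF that by simp
    ultimately show ?thesis by (simp add: closure_of_mono image_mono)
  qed
  have in_F: "X i closure_of (p i j ` F j) \<subseteq> F i" if "i \<in> I" "j \<in> I" "le i j" for i j
  proof (rule closure_of_minimal)
    show "p i j ` F j \<subseteq> F i" "closedin (X i) (F i)"
      using pF Fclosed that by simp_all
  qed
  have "G i \<inter> Q i \<noteq> {}" if "i \<in> I" for i
  proof -
    let ?\<F> = "(\<lambda>j. X i closure_of (p i j ` F j)) ` {j \<in> I. le i j}"
    have "\<Inter>?\<F> \<inter> Q i \<noteq> {}"
    proof (rule compactin_meets_filtered_Inter[OF Q[OF that]])
      show "?\<F> \<noteq> {}" using directed_preorder_refl[OF dir that] that by blast
      show "closedin (X i) A" if "A \<in> ?\<F>" for A using that by auto
      show "A \<inter> Q i \<noteq> {}" if A: "A \<in> ?\<F>" for A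
      proof -
        obtain j where j: "j \<in> I" "le i j" "A = X i closure_of (p i j ` F j)" using A by blast
        obtain z where z: "z \<in> F j" "z \<in> Q j" using FQ[OF j(1)] by blast
        have "p i j ` F j \<subseteq> topspace (X i)"
          using pF[OF \<open>i \<in> I\<close> j(1,2)] Fsub[OF \<open>i \<in> I\<close>] by (rule order_trans)
        then have "p i j z \<in> A"
          using closure_of_subset[of "p i j ` F j" "X i"] z(1) j(3) by blast
        then show ?thesis using pQ[OF \<open>i \<in> I\<close> j(1,2)] z by blast
      qed
      show "\<exists>H\<in>?\<F>. H \<subseteq> A \<inter> B" if AB: "A \<in> ?\<F>" "B \<in> ?\<F>" for A B
      proof -
        obtain j k where jk: "j \<in> I" "le i j" "A = X i closure_of (p i j ` F j)"
          "k \<in> I" "le i k" "B = X i closure_of (p i k ` F k)" using AB by blast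
        then obtain m where m: "m \<in> I" "le j m" "le k m"
          using directed_preorder_upper[OF dir, of j k] by blast
        then have "le i m" using directed_preorder_trans[OF dir] jk \<open>i \<in> I\<close> by blast
        then show ?thesis
          using smaller[of i j m] smaller[of i k m] m jk \<open>i \<in> I\<close> by blast
      qed
    qed
    then show ?thesis using that by (simp add: G_def)
  qed
  moreover have "closedin (X i) (G i)" if "i \<in> I" for i
    unfolding G_def using that directed_preorder_refl[OF dir that]
    by (auto intro!: closedin_Inter)
  moreover have "p i j ` G j \<subseteq> G i" if ij: "i \<in> I" "j \<in> I" "le i j" for i j
  proof -
    have "p i j z \<in> X i closure_of (p i k ` F k)"
      if z: "z \<in> G j" and k: "k \<in> I" "le i k" for z k
    proof -
      obtain m where m: "m \<in> I" "le j m" "le k m"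
        using directed_preorder_upper[OF dir, of j k] ij k by blast
      then have "z \<in> X j closure_of (p j m ` F m)" using z ij by (auto simp: G_def)
      then have "p i j z \<in> X i closure_of (p i j ` p j m ` F m)"
        using continuous_map_image_closure_subset[OF projective_system_continuous[OF ps ij]] by blast
      also have "p i j ` p j m ` F m = p i m ` F m"
        using projective_system_image_comp[OF ps ij(1,2) m(1) ij(3) m(2) Fsub[OF m(1)]] .
      finally show ?thesis using smaller[of i k m] ij k m by blast
    qed
    then show ?thesis using ij by (auto simp: G_def)
  qed
  ultimately have "closed_subsystem I le X p Q G"
    by (simp add: closed_subsystem_def)
  moreover have "G \<le> F"
    using in_F directed_preorder_refl[OF dir] by (fastforce simp: le_fun_def G_def)
  ultimately have "G = F" by (rule minimal)
  moreover have "G i \<subseteq> X i closure_of (p i j ` F j)"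
    using ij(2,3) unfolding G_def if_P[OF ij(1)] by (intro INT_lower) simp
  ultimately have "F i \<subseteq> X i closure_of (p i j ` F j)"
    by simp
  then show ?thesis using in_F[OF ij] by blast
qed

text \<open>If \<open>F i\<close> is not contained in a closed set \<open>A\<close>, intersecting the subsystem with the preimages of \<open>A\<close>
  would make it strictly smaller, so at some \<open>j\<close> the part of \<open>F j\<close> inside \<open>Q j\<close> avoids \<open>A\<close>. If this
  happens for both \<open>A\<close> and \<open>B\<close>, for a common upper index \<open>m\<close> there is a point of \<open>F m\<close> whose image in \<open>F i\<close> lies in
  neither.\<close>

lemma minimal_closed_subsystem_irreducible:
  assumes ps: "projective_system I le X p"
    and pQ: "\<And>i j. i \<in> I \<Longrightarrow> j \<in> I \<Longrightarrow> le i j \<Longrightarrow> p i j ` Q j \<subseteq> Q i"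
    and F: "closed_subsystem I le X p Q F"
    and minimal: "\<And>G. closed_subsystem I le X p Q G \<Longrightarrow> G \<le> F \<Longrightarrow> G = F"
    and i: "i \<in> I"
  shows "irreducible_closedin (X i) (F i)"
proof -
  note dir = projective_system_directed[OF ps]
  note Fclosed = closed_subsystem_closedin[OF F] and Fsub = closed_subsystem_topspace[OF F]
    and FQ = closed_subsystem_meets[OF F] and pF = closed_subsystem_image[OF F]
  have separate: "\<exists>j\<in>I. le i j \<and> (\<forall>z \<in> F j \<inter> Q j. p i j z \<notin> A)"
    if A: "closedin (X i) A" "\<not> F i \<subseteq> A" for A
  proof (rule ccontr)
    assume "\<not> ?thesis"
    then have meets: "\<exists>z\<in>F j \<inter> Q j. p i j z \<in> A" if "j \<in> I" "le i j" for j
      using that by blast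
    define G where "G = (\<lambda>j. if j \<in> I \<and> le i j then {z \<in> F j. p i j z \<in> A} else F j)"
    have "closedin (X j) (G j)" if "j \<in> I" for j
    proof (cases "le i j")
      case True
      have "G j = F j \<inter> {z \<in> topspace (X j). p i j z \<in> A}"
        using True that Fsub[OF that] by (auto simp: G_def)
      then show ?thesis
        using closedin_Int[OF Fclosed[OF that]
            closedin_continuous_map_preimage[OF projective_system_continuous[OF ps i that True] A(1)]]
        by simp
    qed (use Fclosed that in \<open>simp add: G_def\<close>)
    moreover have "G j \<inter> Q j \<noteq> {}" if "j \<in> I" for j
      using meets FQ that unfolding G_def by (cases "le i j") auto
    moreover have "p j k ` G k \<subseteq> G j" if jk: "j \<in> I" "k \<in> I" "le j k" for j k
    proof
      fix w assume "w \<in> p j k ` G k"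
      then obtain z where z: "z \<in> G k" "w = p j k z" by blast
      then have zF: "z \<in> F k" by (auto simp: G_def split: if_splits)
      show "w \<in> G j"
      proof (cases "le i j")
        case True
        then have "le i k" using directed_preorder_trans[OF dir i jk(1,2)] jk by blast
        then have "p i k z \<in> A" using z jk by (simp add: G_def)
        then have "p i j w \<in> A"
          using projective_system_comp[OF ps i jk(1,2) True jk(3)] zF Fsub[OF jk(2)] z by auto
        then show ?thesis using True jk zF z pF[OF jk] by (auto simp: G_def)
      next
        case False
        then show ?thesis using jk zF z pF[OF jk] by (auto simp: G_def)
      qed
    qed
    ultimately have "closed_subsystem I le X p Q G" by (simp add: closed_subsystem_def)
    moreover have "G \<le> F" by (auto simp: G_def le_fun_def)
    ultimately have "G = F" by (rule minimal)
    then have "G i = F i" by simp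
    moreover have "G i \<subseteq> A"
      using i directed_preorder_refl[OF dir i] projective_system_id[OF ps i] Fsub[OF i]
      by (auto simp: G_def)
    ultimately show False using A by blast
  qed
  have "F i \<subseteq> A \<or> F i \<subseteq> B" if AB: "closedin (X i) A" "closedin (X i) B" "F i \<subseteq> A \<union> B" for A B
  proof (rule ccontr)
    assume "\<not> ?thesis"
    then obtain j k where j: "j \<in> I" "le i j" "\<forall>z \<in> F j \<inter> Q j. p i j z \<notin> A"
      and k: "k \<in> I" "le i k" "\<forall>z \<in> F k \<inter> Q k. p i k z \<notin> B"
      using separate AB by meson
    obtain m where m: "m \<in> I" "le j m" "le k m"
      using directed_preorder_upper[OF dir j(1) k(1)] by blast
    obtain z where z: "z \<in> F m" "z \<in> Q m" using FQ m by blast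
    have zm: "z \<in> topspace (X m)" using Fsub m z by blast
    have "p j m z \<in> F j \<inter> Q j" "p k m z \<in> F k \<inter> Q k"
      using pF pQ z m j k by blast+
    then have "p i m z \<notin> A" "p i m z \<notin> B"
      using j k m i zm projective_system_comp[OF ps] by metis+
    moreover have "le i m" using directed_preorder_trans[OF dir i j(1) m(1) j(2) m(2)] .
    then have "p i m z \<in> F i" using pF[OF i m(1)] z by blast
    ultimately show False using AB by blast
  qed
  moreover have "F i \<noteq> {}" using FQ[OF i] by blast
  ultimately show ?thesis using Fclosed[OF i] by (auto simp: irreducible_closedin_def)
qed

text \<open>The coordinates are the generic points of a minimal closed subsystem: density of the images turns
  the generic point of \<open>F j\<close> into a generic point of \<open>F i\<close>, and generic points are unique. The generic
  point need not lie in \<open>Q i\<close>, but it lies above some point of \<open>Q i\<close>, hence in each open set around \<open>Q i\<close>.\<close>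

lemma compact_sober_thread:
  assumes ps: "projective_system I le X p"
    and sober: "\<And>i. i \<in> I \<Longrightarrow> sober_space (X i)"
    and Q: "\<And>i. i \<in> I \<Longrightarrow> compactin (X i) (Q i)"
    and pQ: "\<And>i j. i \<in> I \<Longrightarrow> j \<in> I \<Longrightarrow> le i j \<Longrightarrow> p i j ` Q j \<subseteq> Q i"
    and C: "closed_subsystem I le X p Q C"
  shows "\<exists>x. (\<forall>i\<in>I. x i \<in> C i) \<and> (\<forall>i\<in>I. \<forall>j\<in>I. le i j \<longrightarrow> p i j (x j) = x i) \<and>
    (\<forall>i\<in>I. \<forall>U. openin (X i) U \<and> Q i \<subseteq> U \<longrightarrow> x i \<in> U)"
proof -
  obtain F where F: "closed_subsystem I le X p Q F" "F \<le> C"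
    and minimal: "\<And>G. closed_subsystem I le X p Q G \<Longrightarrow> G \<le> F \<Longrightarrow> G = F"
    using minimal_closed_subsystem[OF Q C] by blast
  have "\<exists>x\<in>topspace (X i). F i = X i closure_of {x}" if "i \<in> I" for i
    using sober[OF that] minimal_closed_subsystem_irreducible[OF ps pQ F(1) minimal that]
    unfolding sober_space_def by blast
  then obtain x where x: "\<And>i. i \<in> I \<Longrightarrow> x i \<in> topspace (X i)"
      "\<And>i. i \<in> I \<Longrightarrow> F i = X i closure_of {x i}"
    by metis
  have xF: "x i \<in> F i" if "i \<in> I" for i
    using x[OF that] by (simp add: in_closure_of)
  have "p i j (x j) = x i" if ij: "i \<in> I" "j \<in> I" "le i j" for i j
  proof (rule sober_space_generic_point_unique[OF sober[OF ij(1)]])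
    have pF: "X i closure_of (p i j ` F j) = F i"
      using minimal_closed_subsystem_dense[OF ps Q pQ F(1) minimal ij] .
    have px: "p i j (x j) \<in> topspace (X i)"
      using projective_system_topspace[OF ps ij] x ij by blast
    then show "p i j (x j) \<in> topspace (X i)" .
    show "x i \<in> topspace (X i)" using x ij by blast
    show "X i closure_of {p i j (x j)} = X i closure_of {x i}"
    proof (rule antisym)
      show "X i closure_of {p i j (x j)} \<subseteq> X i closure_of {x i}"
        unfolding x(2)[OF ij(1), symmetric] pF[symmetric]
        using xF[OF ij(2)] by (intro closure_of_mono) auto
      have "p i j ` F j \<subseteq> X i closure_of {p i j (x j)}"
        using continuous_map_image_closure_subset[OF projective_system_continuous[OF ps ij], of "{x j}"]
          x(2)[OF ij(2)] by simp
      then show "X i closure_of {x i} \<subseteq> X i closure_of {p i j (x j)}"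
        unfolding x(2)[OF ij(1), symmetric] pF[symmetric]
        by (intro closure_of_minimal) auto
    qed
  qed
  moreover have "x i \<in> U" if iU: "i \<in> I" "openin (X i) U" "Q i \<subseteq> U" for i U
  proof -
    obtain z where "z \<in> F i" "z \<in> U"
      using closed_subsystem_meets[OF F(1) iU(1)] iU(3) by blast
    then show ?thesis using x iU by (auto simp: in_closure_of)
  qed
  moreover have "x i \<in> C i" if "i \<in> I" for i
    using xF[OF that] F(2) by (auto simp: le_fun_def)
  ultimately show ?thesis by (intro exI[of _ x]) simp
qed



lemma projective_system_reindex:
  assumes ps: "projective_system I le X p" and dirJ: "directed_preorder J leJ"
    and s: "\<And>j. j \<in> J \<Longrightarrow> s j \<in> I"
    and mono: "\<And>j k. j \<in> J \<Longrightarrow> k \<in> J \<Longrightarrow> leJ j k \<Longrightarrow> le (s j) (s k)"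
  shows "projective_system J leJ (\<lambda>j. X (s j)) (\<lambda>j k. p (s j) (s k))"
  unfolding projective_system_def
proof (intro conjI ballI impI)
  show "directed_preorder J leJ" by (rule dirJ)
  show "continuous_map (X (s k)) (X (s j)) (p (s j) (s k))" if "j \<in> J" "k \<in> J" "leJ j k" for j k
    using projective_system_continuous[OF ps] s mono that by simp
  show "p (s j) (s j) x = x" if "j \<in> J" "x \<in> topspace (X (s j))" for j x
    using projective_system_id[OF ps] s that by simp
  show "p (s j) (s k) (p (s k) (s m) x) = p (s j) (s m) x"
    if "j \<in> J" "k \<in> J" "m \<in> J" "leJ j k \<and> leJ k m" "x \<in> topspace (X (s m))" for j k m x
    using projective_system_comp[OF ps] s mono that by simp
qed

section \<open>Coherent families of closed sets\<close>

text \<open>The condition that characterizes points of the limit of the hyperspaces, stated so that it fits both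
  hyperspaces and constrains no value outside \<open>I\<close>.\<close>

definition coherent_closed_family ::
    "'i set \<Rightarrow> ('i \<Rightarrow> 'i \<Rightarrow> bool) \<Rightarrow> ('i \<Rightarrow> 'a topology) \<Rightarrow> ('i \<Rightarrow> 'i \<Rightarrow> 'a \<Rightarrow> 'a) \<Rightarrow> ('i \<Rightarrow> 'a set) \<Rightarrow> bool" where
  "coherent_closed_family I le X p C \<longleftrightarrow>
     (\<forall>i\<in>I. closedin (X i) (C i)) \<and>
     (\<forall>i\<in>I. \<forall>j\<in>I. le i j \<longrightarrow> X i closure_of (p i j ` C j) = C i)"

text \<open>The inverse of the comparison map, for the systems that satisfy the next definition.\<close>

definition threads_in ::
    "'i set \<Rightarrow> ('i \<Rightarrow> 'i \<Rightarrow> bool) \<Rightarrow> ('i \<Rightarrow> 'a topology) \<Rightarrow> ('i \<Rightarrow> 'i \<Rightarrow> 'a \<Rightarrow> 'a) \<Rightarrow> ('i \<Rightarrow> 'a set) \<Rightarrow> ('i \<Rightarrow> 'a) set" where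
  "threads_in I le X p C = {x \<in> topspace (projective_limit I le X p). \<forall>i\<in>I. x i \<in> C i}"

definition has_dense_threads ::
    "'i set \<Rightarrow> ('i \<Rightarrow> 'i \<Rightarrow> bool) \<Rightarrow> ('i \<Rightarrow> 'a topology) \<Rightarrow> ('i \<Rightarrow> 'i \<Rightarrow> 'a \<Rightarrow> 'a) \<Rightarrow> bool" where
  "has_dense_threads I le X p \<longleftrightarrow>
     (\<forall>C i U. coherent_closed_family I le X p C \<and> i \<in> I \<and> openin (X i) U \<and> C i \<inter> U \<noteq> {} \<longrightarrow>
        (\<exists>x\<in>threads_in I le X p C. x i \<in> U))"

lemma coherent_closed_family_rules:
  assumes "projective_system I le X p" "coherent_closed_family I le X p C"
  shows coherent_closed_family_closedin: "\<And>i. i \<in> I \<Longrightarrow> closedin (X i) (C i)"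
    and coherent_closed_family_topspace: "\<And>i. i \<in> I \<Longrightarrow> C i \<subseteq> topspace (X i)"
    and coherent_closed_family_closure:
      "\<And>i j. i \<in> I \<Longrightarrow> j \<in> I \<Longrightarrow> le i j \<Longrightarrow> X i closure_of (p i j ` C j) = C i"
    and coherent_closed_family_image: "\<And>i j. i \<in> I \<Longrightarrow> j \<in> I \<Longrightarrow> le i j \<Longrightarrow> p i j ` C j \<subseteq> C i"
proof -
  show closed: "closedin (X i) (C i)" if "i \<in> I" for i
    using assms that by (simp add: coherent_closed_family_def)
  show sub: "C i \<subseteq> topspace (X i)" if "i \<in> I" for i
    using closedin_subset[OF closed[OF that]] .
  show cl: "X i closure_of (p i j ` C j) = C i" if "i \<in> I" "j \<in> I" "le i j" for i j
    using assms that by (simp add: coherent_closed_family_def)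
  show "p i j ` C j \<subseteq> C i" if ij: "i \<in> I" "j \<in> I" "le i j" for i j
  proof -
    have "p i j ` C j \<subseteq> topspace (X i)"
      using projective_system_topspace[OF assms(1) ij] sub[OF ij(2)] by blast
    then show ?thesis using closure_of_subset[of "p i j ` C j" "X i"] cl[OF ij] by simp
  qed
qed

text \<open>Membership in the family needs to be checked on a cofinal set only, as the bonding maps send
  \<open>C j\<close> into \<open>C i\<close>.\<close>

lemma thread_from_cofinal:
  assumes ps: "projective_system I le X p" and C: "coherent_closed_family I le X p C"
    and dirJ: "directed_preorder J leJ"
    and s: "\<And>j. j \<in> J \<Longrightarrow> s j \<in> I"
    and mono: "\<And>j k. j \<in> J \<Longrightarrow> k \<in> J \<Longrightarrow> leJ j k \<Longrightarrow> le (s j) (s k)"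
    and cofinal: "\<And>i. i \<in> I \<Longrightarrow> \<exists>j\<in>J. le i (s j)"
    and x: "\<And>j. j \<in> J \<Longrightarrow> x j \<in> C (s j)"
    and thread: "\<And>j k. j \<in> J \<Longrightarrow> k \<in> J \<Longrightarrow> leJ j k \<Longrightarrow> p (s j) (s k) (x k) = x j"
  shows "\<exists>y\<in>threads_in I le X p C. \<forall>j\<in>J. y (s j) = x j"
proof -
  have xtop: "x j \<in> topspace (X (s j))" if "j \<in> J" for j
    using coherent_closed_family_topspace[OF ps C s[OF that]] x[OF that] by blast
  obtain y where y: "y \<in> topspace (projective_limit I le X p)" "\<And>j. j \<in> J \<Longrightarrow> y (s j) = x j"
    by (rule extend_thread[OF ps dirJ, where s = s and x = x])
      (simp_all add: s mono cofinal xtop thread)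
  have "y i \<in> C i" if i: "i \<in> I" for i
  proof -
    obtain j where j: "j \<in> J" "le i (s j)" using cofinal[OF i] by blast
    have "p i (s j) (y (s j)) = y i"
      using y(1) i j s[OF j(1)] by (simp add: topspace_projective_limit)
    then show ?thesis
      using coherent_closed_family_image[OF ps C i s[OF j(1)] j(2)] x[OF j(1)] y(2)[OF j(1)] by force
  qed
  then show ?thesis using y by (auto simp: threads_in_def)
qed

lemma thread_from_above:
  assumes ps: "projective_system I le X p" and C: "coherent_closed_family I le X p C" and i: "i \<in> I"
    and x: "\<And>j. j \<in> I \<Longrightarrow> le i j \<Longrightarrow> x j \<in> C j"
    and thread: "\<And>j k. j \<in> I \<Longrightarrow> k \<in> I \<Longrightarrow> le i j \<Longrightarrow> le j k \<Longrightarrow> p j k (x k) = x j"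
  shows "\<exists>y\<in>threads_in I le X p C. y i = x i"
proof -
  note dir = projective_system_directed[OF ps]
  have cofinal: "\<exists>j\<in>{j\<in>I. le i j}. le k j" if "k \<in> I" for k
    using directed_preorder_upper[OF dir i that] by blast
  have "\<exists>y\<in>threads_in I le X p C. \<forall>j\<in>{j\<in>I. le i j}. y j = x j"
    by (rule thread_from_cofinal[OF ps C directed_preorder_above[OF dir i], where s = "\<lambda>j. j"])
      (use cofinal x thread in simp_all)
  then show ?thesis using directed_preorder_refl[OF dir i] i by blast
qed

lemma ep_system_dense_threads:
  assumes "ep_system I le X p"
  shows "has_dense_threads I le X p"
  unfolding has_dense_threads_def
proof (intro allI impI, elim conjE)
  fix C i U
  assume C: "coherent_closed_family I le X p C" and i: "i \<in> I"
    and "openin (X i) U" and "C i \<inter> U \<noteq> {}"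
  have ps: "projective_system I le X p" using assms by (simp add: ep_system_def)
  note dir = projective_system_directed[OF ps]
  obtain e where ep:
      "\<forall>i\<in>I. \<forall>j\<in>I. le i j \<longrightarrow> continuous_map (X i) (X j) (e i j) \<and>
         (\<forall>x\<in>topspace (X i). p i j (e i j x) = x) \<and>
         (\<forall>x\<in>topspace (X j). spec_le (X j) (e i j (p i j x)) x)"
      "\<forall>i\<in>I. \<forall>x\<in>topspace (X i). e i i x = x"
      "\<forall>i\<in>I. \<forall>j\<in>I. \<forall>k\<in>I. le i j \<and> le j k \<longrightarrow> (\<forall>x\<in>topspace (X i). e j k (e i j x) = e i k x)"
    using assms unfolding ep_system_def by (elim exE conjE)
  have e: "\<And>j. j \<in> I \<Longrightarrow> le i j \<Longrightarrow> continuous_map (X i) (X j) (e i j)"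
      "\<And>j k x. j \<in> I \<Longrightarrow> k \<in> I \<Longrightarrow> le j k \<Longrightarrow> x \<in> topspace (X j) \<Longrightarrow> p j k (e j k x) = x"
      "\<And>j x. j \<in> I \<Longrightarrow> le i j \<Longrightarrow> x \<in> topspace (X j) \<Longrightarrow> spec_le (X j) (e i j (p i j x)) x"
      "\<And>x. x \<in> topspace (X i) \<Longrightarrow> e i i x = x"
      "\<And>j k x. j \<in> I \<Longrightarrow> k \<in> I \<Longrightarrow> le i j \<Longrightarrow> le j k \<Longrightarrow> x \<in> topspace (X i) \<Longrightarrow>
         e j k (e i j x) = e i k x"
    using ep i by simp_all
  obtain z where z: "z \<in> C i" "z \<in> U" using \<open>C i \<inter> U \<noteq> {}\<close> by blast
  have ztop: "z \<in> topspace (X i)" using coherent_closed_family_topspace[OF ps C i] z by blast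
  \<comment> \<open>The retraction \<open>e i j \<circ> p i j\<close> lies below the identity, so it preserves the closed set \<open>C j\<close>; and
    \<open>C i\<close> is the closure of the image of \<open>C j\<close> under \<open>p i j\<close>.\<close>
  have ez: "e i j z \<in> C j" if j: "j \<in> I" "le i j" for j
  proof -
    have "e i j ` p i j ` C j \<subseteq> C j"
    proof (intro subsetI, elim imageE)
      fix w v u assume "w = e i j v" "v = p i j u" "u \<in> C j"
      moreover have "u \<in> topspace (X j)"
        using coherent_closed_family_topspace[OF ps C j(1)] \<open>u \<in> C j\<close> by blast
      ultimately show "w \<in> C j"
        using spec_le_in_closed[OF coherent_closed_family_closedin[OF ps C j(1)] e(3)[OF j]] by simp
    qed
    then have "X j closure_of (e i j ` p i j ` C j) \<subseteq> C j"
      using coherent_closed_family_closedin[OF ps C j(1)] by (rule closure_of_minimal)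
    moreover have "e i j ` (X i closure_of (p i j ` C j)) \<subseteq> X j closure_of (e i j ` p i j ` C j)"
      by (rule continuous_map_image_closure_subset[OF e(1)[OF j]])
    ultimately show ?thesis
      using coherent_closed_family_closure[OF ps C i j] z(1) by blast
  qed
  have "p j k (e i k z) = e i j z" if jk: "j \<in> I" "k \<in> I" "le i j" "le j k" for j k
  proof -
    have "e i j z \<in> topspace (X j)"
      using ez jk coherent_closed_family_topspace[OF ps C jk(1)] by blast
    then show ?thesis
      using e(2)[of j k "e i j z"] e(5)[OF jk ztop] jk by simp
  qed
  then have "\<exists>y\<in>threads_in I le X p C. y i = e i i z"
    by (intro thread_from_above[OF ps C i] ez) simp_all
  then obtain y where "y \<in> threads_in I le X p C" "y i = e i i z" by blast
  then show "\<exists>x\<in>threads_in I le X p C. x i \<in> U"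
    using e(4)[OF ztop] z(2) by auto
qed

text \<open>Since \<open>p i j\<close> is proper, the downward closure of the image of \<open>C j\<close> is closed, hence contains
  \<open>C i\<close>: every point \<open>z\<close> of \<open>C i\<close> lies below the image of a point of \<open>C j\<close>. So \<open>C j\<close> meets the preimage
  of the points above \<open>z\<close>, and properness makes that preimage compact.\<close>

lemma proper_sober_dense_threads:
  assumes ps: "projective_system I le X p"
    and sober: "\<And>i. i \<in> I \<Longrightarrow> sober_space (X i)"
    and proper: "\<And>i j. i \<in> I \<Longrightarrow> j \<in> I \<Longrightarrow> le i j \<Longrightarrow> saturated_proper_map (X j) (X i) (p i j)"
  shows "has_dense_threads I le X p"
  unfolding has_dense_threads_def
proof (intro allI impI, elim conjE)
  fix C i U
  assume C: "coherent_closed_family I le X p C" and i: "i \<in> I"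
    and U: "openin (X i) U" and "C i \<inter> U \<noteq> {}"
  note dir = projective_system_directed[OF ps]
  obtain z where z: "z \<in> C i" "z \<in> U" using \<open>C i \<inter> U \<noteq> {}\<close> by blast
  have ztop: "z \<in> topspace (X i)" using coherent_closed_family_topspace[OF ps C i] z by blast
  let ?J = "{j \<in> I. le i j}"
  define Q where "Q = (\<lambda>j. {u \<in> topspace (X j). p i j u \<in> {y. spec_le (X i) z y}})"
  have psJ: "projective_system ?J le X p"
    using projective_system_reindex[OF ps directed_preorder_above[OF dir i], of "\<lambda>j. j"] by simp
  have Qcompact: "compactin (X j) (Q j)" if "j \<in> ?J" for j
  proof -
    have "saturated_proper_map (X j) (X i) (p i j)" using proper[OF i] that by simp
    then have "compactin (X i) S \<and> saturated_in (X i) S \<longrightarrow> compactin (X j) {u \<in> topspace (X j). p i j u \<in> S}" for S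
      by (simp add: saturated_proper_map_def)
    from this[of "{y. spec_le (X i) z y}"] show ?thesis
      using compactin_up_closure_of_point[OF ztop] saturated_in_up_closure_of_point[of "X i" z]
      unfolding Q_def by argo
  qed
  have pQ: "p j k ` Q k \<subseteq> Q j" if jk: "j \<in> ?J" "k \<in> ?J" "le j k" for j k
  proof
    fix w assume "w \<in> p j k ` Q k"
    then obtain u where u: "w = p j k u" "u \<in> topspace (X k)" "spec_le (X i) z (p i k u)"
      unfolding Q_def by blast
    moreover have "p j k u \<in> topspace (X j)" "p i j (p j k u) = p i k u"
      using projective_system_topspace[OF ps _ _ jk(3) u(2)]
        projective_system_comp[OF ps i _ _ _ jk(3) u(2)] jk by simp_all
    ultimately show "w \<in> Q j" by (simp add: Q_def)
  qed
  have "C j \<inter> Q j \<noteq> {}" if j: "j \<in> ?J" for j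
  proof -
    have "closedin (X i) (down_closure (X i) (p i j ` C j))"
      using proper[OF i, of j] coherent_closed_family_closedin[OF ps C, of j] j
      unfolding saturated_proper_map_def by simp
    moreover have "p i j ` C j \<subseteq> down_closure (X i) (p i j ` C j)"
    proof
      fix w assume w: "w \<in> p i j ` C j"
      have "p i j ` C j \<subseteq> topspace (X i)"
        using order_trans[OF coherent_closed_family_image[OF ps C i] coherent_closed_family_topspace[OF ps C i]]
          j by simp
      then have "w \<in> topspace (X i)" using w by (rule subsetD)
      then show "w \<in> down_closure (X i) (p i j ` C j)"
        unfolding down_closure_def by (intro CollectI bexI[OF _ w] spec_le_refl)
    qed
    ultimately have "X i closure_of (p i j ` C j) \<subseteq> down_closure (X i) (p i j ` C j)"
      by (intro closure_of_minimal)
    then have "C i \<subseteq> down_closure (X i) (p i j ` C j)"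
      using coherent_closed_family_closure[OF ps C i, of j] j by simp
    then have "z \<in> down_closure (X i) (p i j ` C j)" using z(1) by (rule subsetD)
    then obtain u where u: "u \<in> C j" "spec_le (X i) z (p i j u)"
      unfolding down_closure_def by blast
    moreover have "u \<in> topspace (X j)"
      using coherent_closed_family_topspace[OF ps C, of j] j u(1) by blast
    ultimately show ?thesis unfolding Q_def by blast
  qed
  then have subsystem: "closed_subsystem ?J le X p Q C"
    using coherent_closed_family_closedin[OF ps C] coherent_closed_family_image[OF ps C]
    by (simp add: closed_subsystem_def)
  have soberJ: "sober_space (X j)" if "j \<in> ?J" for j using sober that by blast
  have "\<exists>x. (\<forall>j\<in>?J. x j \<in> C j) \<and> (\<forall>j\<in>?J. \<forall>k\<in>?J. le j k \<longrightarrow> p j k (x k) = x j) \<and>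
      (\<forall>j\<in>?J. \<forall>V. openin (X j) V \<and> Q j \<subseteq> V \<longrightarrow> x j \<in> V)"
    by (rule compact_sober_thread[OF psJ soberJ Qcompact pQ subsystem])
  then obtain x where x: "\<forall>j\<in>?J. x j \<in> C j"
      "\<forall>j\<in>?J. \<forall>k\<in>?J. le j k \<longrightarrow> p j k (x k) = x j"
      "\<forall>j\<in>?J. \<forall>V. openin (X j) V \<and> Q j \<subseteq> V \<longrightarrow> x j \<in> V"
    by (elim exE conjE)
  have threads: "p j k (x k) = x j" if "j \<in> I" "k \<in> I" "le i j" "le j k" for j k
    using x(2) that directed_preorder_trans[OF dir i that(1,2)] by simp
  have "x j \<in> C j" if "j \<in> I" "le i j" for j using x(1) that by simp
  from thread_from_above[where x = x, OF ps C i this threads]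
  have "\<exists>y\<in>threads_in I le X p C. y i = x i" .
  then obtain y where y: "y \<in> threads_in I le X p C" "y i = x i" by blast
  have "Q i \<subseteq> U"
  proof
    fix u assume "u \<in> Q i"
    then have "u \<in> topspace (X i)" "spec_le (X i) z (p i i u)" by (simp_all add: Q_def)
    then have "spec_le (X i) z u" using projective_system_id[OF ps i, of u] by simp
    then show "u \<in> U" using U z(2) by (simp add: spec_le_def)
  qed
  then have "x i \<in> U"
    using x(3) U i directed_preorder_refl[OF dir i] by simp
  with y show "\<exists>x\<in>threads_in I le X p C. x i \<in> U" by (intro bexI[of _ y]) simp_all
qed

lemma countable_cofinal_sequence:
  assumes dir: "directed_preorder I le" and "has_countable_cofinal I le" and i: "i \<in> I"
  shows "\<exists>s :: nat \<Rightarrow> _. s 0 = i \<and> (\<forall>n. s n \<in> I) \<and> (\<forall>m n. m \<le> n \<longrightarrow> le (s m) (s n)) \<and>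
    (\<forall>k\<in>I. \<exists>n. le k (s n))"
proof -
  obtain J where J: "J \<subseteq> I" "countable J" "\<And>k. k \<in> I \<Longrightarrow> \<exists>j\<in>J. le k j"
    using assms(2) unfolding has_countable_cofinal_def by blast
  have "J \<noteq> {}" using J(3)[OF i] by blast
  define g where "g = from_nat_into J"
  have g: "g n \<in> I" for n
    using from_nat_into[OF \<open>J \<noteq> {}\<close>] J(1) by (auto simp: g_def)
  have "\<exists>s. \<forall>n. (s n \<in> I \<and> (n = 0 \<longrightarrow> s n = i)) \<and> (le (s n) (s (Suc n)) \<and> le (g n) (s (Suc n)))"
    by (rule dependent_nat_choice) (use i directed_preorder_upper[OF dir _ g] in auto)
  then obtain s where s: "\<And>n. s n \<in> I" "s 0 = i" "\<And>n. le (s n) (s (Suc n))" "\<And>n. le (g n) (s (Suc n))"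
    by blast
  have "le (s m) (s n)" if "m \<le> n" for m n
    using that
  proof (induction rule: dec_induct)
    case base
    then show ?case using directed_preorder_refl[OF dir s(1)] .
  next
    case (step n)
    then show ?case using directed_preorder_trans[OF dir s(1) s(1) s(1) _ s(3)] by blast
  qed
  moreover have "\<exists>n. le k (s n)" if k: "k \<in> I" for k
  proof -
    obtain j where j: "j \<in> J" "le k j" using J(3)[OF k] by blast
    then obtain n where "g n = j"
      using from_nat_into_surj[OF J(2)] unfolding g_def by blast
    then show ?thesis
      using directed_preorder_trans[OF dir k g s(1) _ s(4)] j(2) by blast
  qed
  ultimately show ?thesis using s(1,2) by (intro exI[of _ s]) simp
qed

text \<open>Along a cofinal sequence that starts at \<open>i\<close>, choose compact sets \<open>Q n\<close> whose interiors meet the family.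
  The interior is what makes the next step possible: its preimage is open and still meets the family,
  because the image of the next closed set is dense in the present one.\<close>

lemma locally_compact_sober_dense_threads:
  assumes ps: "projective_system I le X p" and countable: "has_countable_cofinal I le"
    and lc: "\<And>i. i \<in> I \<Longrightarrow> base_locally_compact_space (X i)"
    and sober: "\<And>i. i \<in> I \<Longrightarrow> sober_space (X i)"
  shows "has_dense_threads I le X p"
  unfolding has_dense_threads_def
proof (intro allI impI, elim conjE)
  fix C i U
  assume C: "coherent_closed_family I le X p C" and i: "i \<in> I"
    and U: "openin (X i) U" and CU: "C i \<inter> U \<noteq> {}"
  note dir = projective_system_directed[OF ps]
  obtain s :: "nat \<Rightarrow> 'a" where seq: "s 0 = i" "\<forall>n. s n \<in> I" "\<forall>m n. m \<le> n \<longrightarrow> le (s m) (s n)"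
    "\<forall>k\<in>I. \<exists>n. le k (s n)"
    using countable_cofinal_sequence[OF dir countable i] by (elim exE conjE)
  from seq have s0: "s 0 = i" and s: "\<And>n. s n \<in> I" and mono: "\<And>m n. m \<le> n \<Longrightarrow> le (s m) (s n)"
    and cofinal: "\<And>k. k \<in> I \<Longrightarrow> \<exists>n. le k (s n)"
    by simp_all
  have "\<exists>k\<in>UNIV. m \<le> k \<and> n \<le> k" for m n :: nat
    by (rule bexI[of _ "max m n"]) simp_all
  then have dirN: "directed_preorder UNIV ((\<le>) :: nat \<Rightarrow> nat \<Rightarrow> bool)"
    unfolding directed_preorder_def by (simp add: reflp_on_def transp_on_def)
  have psN: "projective_system UNIV (\<le>) (\<lambda>n. X (s n)) (\<lambda>m n. p (s m) (s n))"
    by (rule projective_system_reindex[OF ps dirN s mono])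
  \<comment> \<open>Only the first compact set is required to lie in \<open>U\<close>; the others project into it.\<close>
  let ?P = "\<lambda>n Q. compactin (X (s n)) Q \<and> (n = 0 \<longrightarrow> Q \<subseteq> U) \<and>
     (\<exists>V. openin (X (s n)) V \<and> V \<subseteq> Q \<and> C (s n) \<inter> V \<noteq> {})"
  have refine: "\<exists>Q. compactin (X (s n)) Q \<and> Q \<subseteq> W \<and> (\<exists>V. openin (X (s n)) V \<and> V \<subseteq> Q \<and> C (s n) \<inter> V \<noteq> {})"
    if W: "openin (X (s n)) W" "C (s n) \<inter> W \<noteq> {}" for n W
  proof -
    obtain z where z: "z \<in> C (s n)" "z \<in> W" using W(2) by blast
    have "\<exists>V Q. openin (X (s n)) V \<and> compactin (X (s n)) Q \<and> z \<in> V \<and> V \<subseteq> Q \<and> Q \<subseteq> W"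
      using lc[OF s] W(1) z(2) unfolding base_locally_compact_space_def neighbourhood_base_of by simp
    then obtain V Q where VQ: "openin (X (s n)) V" "compactin (X (s n)) Q" "z \<in> V" "V \<subseteq> Q" "Q \<subseteq> W"
      by (elim exE conjE)
    have "C (s n) \<inter> V \<noteq> {}" using z(1) VQ(3) by blast
    then show ?thesis using VQ by (intro exI[of _ Q] conjI exI[of _ V])
  qed
  have "\<exists>Q. \<forall>n. ?P n (Q n) \<and> p (s n) (s (Suc n)) ` Q (Suc n) \<subseteq> Q n"
  proof (rule dependent_nat_choice)
    show "\<exists>Q. ?P 0 Q" using refine[of 0 U] U CU s0 by simp
  next
    fix Q n assume "?P n Q"
    then obtain V where V: "openin (X (s n)) V" "V \<subseteq> Q" "C (s n) \<inter> V \<noteq> {}"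
      by (elim exE conjE)
    let ?W = "{u \<in> topspace (X (s (Suc n))). p (s n) (s (Suc n)) u \<in> V}"
    have le: "le (s n) (s (Suc n))" by (rule mono) simp
    have "openin (X (s (Suc n))) ?W"
      by (rule openin_continuous_map_preimage[OF projective_system_continuous[OF ps s s le] V(1)])
    moreover have "C (s (Suc n)) \<inter> ?W \<noteq> {}"
    proof -
      have "V \<inter> p (s n) (s (Suc n)) ` C (s (Suc n)) \<noteq> {}"
        using V(3) openin_Int_closure_of_eq_empty[OF V(1), of "p (s n) (s (Suc n)) ` C (s (Suc n))"]
        unfolding coherent_closed_family_closure[OF ps C s s le] by (simp add: Int_commute)
      then show ?thesis using coherent_closed_family_topspace[OF ps C s, of "Suc n"] by blast
    qed
    ultimately have "\<exists>Q'. compactin (X (s (Suc n))) Q' \<and> Q' \<subseteq> ?W \<and>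
        (\<exists>V. openin (X (s (Suc n))) V \<and> V \<subseteq> Q' \<and> C (s (Suc n)) \<inter> V \<noteq> {})"
      by (rule refine)
    then obtain Q' where Q': "compactin (X (s (Suc n))) Q'" "Q' \<subseteq> ?W"
        "\<exists>V. openin (X (s (Suc n))) V \<and> V \<subseteq> Q' \<and> C (s (Suc n)) \<inter> V \<noteq> {}"
      by blast
    have "p (s n) (s (Suc n)) ` Q' \<subseteq> Q" using Q'(2) V(2) by blast
    with Q' have "?P (Suc n) Q' \<and> p (s n) (s (Suc n)) ` Q' \<subseteq> Q" by simp
    then show "\<exists>Q'. ?P (Suc n) Q' \<and> p (s n) (s (Suc n)) ` Q' \<subseteq> Q" ..
  qed
  then obtain Q where Q: "\<forall>n. ?P n (Q n) \<and> p (s n) (s (Suc n)) ` Q (Suc n) \<subseteq> Q n" ..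
  then have Qcompact: "compactin (X (s n)) (Q n)" and shrink: "p (s n) (s (Suc n)) ` Q (Suc n) \<subseteq> Q n"
    and Q0: "Q 0 \<subseteq> U" for n
    by simp_all
  have CQ: "C (s n) \<inter> Q n \<noteq> {}" for n
  proof -
    obtain V where "V \<subseteq> Q n" "C (s n) \<inter> V \<noteq> {}" using Q by meson
    then show ?thesis by blast
  qed
  have pQ: "p (s m) (s n) ` Q n \<subseteq> Q m" if "m \<le> n" for m n
    using that
  proof (induction rule: dec_induct)
    case base
    then show ?case
      using projective_system_id[OF ps s, of _ m] compactin_subset_topspace[OF Qcompact[of m]] by force
  next
    case (step n)
    have "p (s m) (s (Suc n)) ` Q (Suc n) = p (s m) (s n) ` p (s n) (s (Suc n)) ` Q (Suc n)"
      using projective_system_image_comp[OF ps s s s mono[OF step(1)] mono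
          compactin_subset_topspace[OF Qcompact]] by simp
    also have "\<dots> \<subseteq> p (s m) (s n) ` Q n"
      by (rule image_mono[OF shrink])
    finally show ?case using step.IH by blast
  qed
  have subsystem: "closed_subsystem UNIV (\<le>) (\<lambda>n. X (s n)) (\<lambda>m n. p (s m) (s n)) Q (\<lambda>n. C (s n))"
    unfolding closed_subsystem_def
    using coherent_closed_family_closedin[OF ps C s] coherent_closed_family_image[OF ps C s s mono] CQ
    by simp
  obtain x where "\<forall>n\<in>UNIV. x n \<in> C (s n)"
      "\<forall>m\<in>UNIV. \<forall>n\<in>UNIV. m \<le> n \<longrightarrow> p (s m) (s n) (x n) = x m"
      "\<forall>n\<in>UNIV. \<forall>V. openin (X (s n)) V \<and> Q n \<subseteq> V \<longrightarrow> x n \<in> V"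
    using compact_sober_thread[OF psN sober[OF s] Qcompact pQ subsystem] by auto
  then have x: "\<And>n. x n \<in> C (s n)" "\<And>m n. m \<le> n \<Longrightarrow> p (s m) (s n) (x n) = x m"
      "\<And>n V. openin (X (s n)) V \<Longrightarrow> Q n \<subseteq> V \<Longrightarrow> x n \<in> V"
    by simp_all
  have "\<exists>y\<in>threads_in I le X p C. \<forall>n\<in>UNIV. y (s n) = x n"
    by (rule thread_from_cofinal[OF ps C dirN, where s = s]) (use s mono cofinal x(1,2) in simp_all)
  moreover have "x 0 \<in> U" using x(3)[of 0 U] U Q0 s0 by simp
  ultimately show "\<exists>x\<in>threads_in I le X p C. x i \<in> U" using s0 by (metis UNIV_I)
qed

section \<open>The lower Vietoris topology\<close>

lemma openin_lower_vietoris_diamond: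
  "openin X U \<Longrightarrow> openin (lower_vietoris_on \<C> X) {C \<in> \<C>. C \<inter> U \<noteq> {}}"
  unfolding lower_vietoris_on_def by (rule topology_generated_by_Basis) blast

text \<open>The carrier is itself a generator of the topology; its preimage is the whole space by the first
  assumption.\<close>

lemma continuous_map_into_lower_vietoris:
  assumes "\<And>x. x \<in> topspace T \<Longrightarrow> f x \<in> \<C>"
    and "\<And>U. openin X U \<Longrightarrow> openin T {x \<in> topspace T. f x \<inter> U \<noteq> {}}"
  shows "continuous_map T (lower_vietoris_on \<C> X) f"
  unfolding lower_vietoris_on_def
proof (rule continuous_on_generated_topo)
  show "f ` topspace T \<subseteq> \<Union> (insert \<C> {{C \<in> \<C>. C \<inter> U \<noteq> {}} |U. openin X U})"
    using assms(1) by blast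
next
  fix W assume "W \<in> insert \<C> {{C \<in> \<C>. C \<inter> U \<noteq> {}} |U. openin X U}"
  then consider "W = \<C>" | U where "openin X U" "W = {C \<in> \<C>. C \<inter> U \<noteq> {}}" by blast
  then show "openin T (f -` W \<inter> topspace T)"
  proof cases
    case 1
    then have "f -` W \<inter> topspace T = topspace T" using assms(1) by blast
    then show ?thesis by simp
  next
    case 2
    then have "f -` W \<inter> topspace T = {x \<in> topspace T. f x \<inter> U \<noteq> {}}" using assms(1) by blast
    then show ?thesis using assms(2)[OF 2(1)] by simp
  qed
qed

text \<open>A flag treats both hyperspaces at once: it tells whether the empty closed set is a point.\<close>

definition closed_sets :: "bool \<Rightarrow> 'a topology \<Rightarrow> 'a set set" where
  "closed_sets with_empty X = {C. closedin X C \<and> (with_empty \<or> C \<noteq> {})}"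

definition hyperspace :: "bool \<Rightarrow> 'a topology \<Rightarrow> 'a set topology" where
  "hyperspace with_empty X = lower_vietoris_on (closed_sets with_empty X) X"

lemma topspace_hyperspace [simp]: "topspace (hyperspace b X) = closed_sets b X"
  by (simp add: hyperspace_def)

lemma hoare_space_eq_hyperspace: "hoare_space X = hyperspace False X"
  and hoare0_space_eq_hyperspace: "hoare0_space X = hyperspace True X"
  by (simp_all add: hoare_space_def hoare0_space_def hyperspace_def closed_sets_def)

text \<open>An open set does not distinguish a set from its closure, so the closure in the functorial action is
  invisible to subbasic open sets.\<close>

lemma hoare_map_meets:
  assumes "openin Y U"
  shows "hoare_map Y f C \<inter> U \<noteq> {} \<longleftrightarrow> (\<exists>x\<in>C. f x \<in> U)"
  using openin_Int_closure_of_eq_empty[OF assms, of "f ` C"] unfolding hoare_map_def by blast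

lemma hoare_map_in_closed_sets:
  assumes "continuous_map X Y f" "C \<in> closed_sets b X"
  shows "hoare_map Y f C \<in> closed_sets b Y"
proof -
  have "f ` C \<subseteq> topspace Y"
    using continuous_map_image_subset_topspace[OF assms(1)] assms(2) closedin_subset
    unfolding closed_sets_def by blast
  then have "f ` C \<subseteq> hoare_map Y f C"
    unfolding hoare_map_def by (rule closure_of_subset)
  then show ?thesis
    using assms(2) by (auto simp: closed_sets_def hoare_map_def)
qed

lemma continuous_map_hoare_map:
  assumes f: "continuous_map X Y f"
  shows "continuous_map (hyperspace b X) (hyperspace b Y) (hoare_map Y f)"
proof -
  have "openin (hyperspace b X) {C \<in> closed_sets b X. hoare_map Y f C \<inter> U \<noteq> {}}"
    if U: "openin Y U" for U
  proof -
    have "{C \<in> closed_sets b X. hoare_map Y f C \<inter> U \<noteq> {}} =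
          {C \<in> closed_sets b X. C \<inter> {x \<in> topspace X. f x \<in> U} \<noteq> {}}"
      using closedin_subset unfolding hoare_map_meets[OF U] closed_sets_def by blast
    then show ?thesis
      using openin_lower_vietoris_diamond[OF openin_continuous_map_preimage[OF f U]]
      by (simp add: hyperspace_def)
  qed
  then show ?thesis
    using hoare_map_in_closed_sets[OF f] unfolding hyperspace_def[of b Y]
    by (intro continuous_map_into_lower_vietoris) auto
qed

lemma hoare_map_comp:
  assumes f: "continuous_map X Y f" and g: "continuous_map Y Z g" and C: "C \<subseteq> topspace X"
  shows "hoare_map Z g (hoare_map Y f C) = hoare_map Z (\<lambda>x. g (f x)) C"
  unfolding hoare_map_def
proof (rule antisym)
  have eq: "(\<lambda>x. g (f x)) ` C = g ` f ` C" by (simp add: image_image)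
  have "g ` (Y closure_of f ` C) \<subseteq> Z closure_of g ` f ` C"
    by (rule continuous_map_image_closure_subset[OF g])
  then show "Z closure_of g ` (Y closure_of f ` C) \<subseteq> Z closure_of (\<lambda>x. g (f x)) ` C"
    unfolding eq by (rule closure_of_minimal) simp
  have "f ` C \<subseteq> topspace Y"
    using continuous_map_image_subset_topspace[OF f] C by blast
  then show "Z closure_of (\<lambda>x. g (f x)) ` C \<subseteq> Z closure_of g ` (Y closure_of f ` C)"
    unfolding eq by (intro closure_of_mono image_mono closure_of_subset)
qed

lemma hoare_map_cong: "(\<And>x. x \<in> C \<Longrightarrow> f x = g x) \<Longrightarrow> hoare_map Y f C = hoare_map Y g C"
  unfolding hoare_map_def by (simp cong: image_cong)

lemma projective_system_hyperspace:
  assumes ps: "projective_system I le X p"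
  shows "projective_system I le (\<lambda>i. hyperspace b (X i)) (\<lambda>i j. hoare_map (X i) (p i j))"
  unfolding projective_system_def
proof (intro conjI ballI impI)
  have sub: "C \<subseteq> topspace (X i)" if "C \<in> topspace (hyperspace b (X i))" for C i
    using that closedin_subset by (auto simp: closed_sets_def)
  show "directed_preorder I le" by (rule projective_system_directed[OF ps])
  show "continuous_map (hyperspace b (X j)) (hyperspace b (X i)) (hoare_map (X i) (p i j))"
    if "i \<in> I" "j \<in> I" "le i j" for i j
    by (rule continuous_map_hoare_map[OF projective_system_continuous[OF ps that]])
  show "hoare_map (X i) (p i i) C = C" if "i \<in> I" "C \<in> topspace (hyperspace b (X i))" for i C
  proof -
    have "p i i ` C = C"
      using projective_system_id[OF ps that(1)] sub[OF that(2)] by (force simp: image_iff)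
    then show ?thesis
      using that(2) by (simp add: hoare_map_def closed_sets_def closure_of_closedin)
  qed
  show "hoare_map (X i) (p i j) (hoare_map (X j) (p j k) C) = hoare_map (X i) (p i k) C"
    if ijk: "i \<in> I" "j \<in> I" "k \<in> I" "le i j \<and> le j k" "C \<in> topspace (hyperspace b (X k))" for i j k C
  proof -
    have "hoare_map (X i) (p i j) (hoare_map (X j) (p j k) C) = hoare_map (X i) (\<lambda>x. p i j (p j k x)) C"
      using hoare_map_comp[OF projective_system_continuous[OF ps, of j k]
          projective_system_continuous[OF ps, of i j] sub[OF ijk(5)]] ijk by simp
    also have "\<dots> = hoare_map (X i) (p i k) C"
      using projective_system_comp[OF ps ijk(1,2,3)] ijk(4) sub[OF ijk(5)]
      by (intro hoare_map_cong) blast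
    finally show ?thesis .
  qed
qed

section \<open>Hyperspaces and projective limits\<close>

text \<open>A point outside the closed set \<open>C\<close> has a neighborhood disjoint from \<open>C\<close> that constrains one coordinate
  only, so that coordinate is outside the closure of the projection of \<open>C\<close>.\<close>

lemma threads_in_hoare_map_eq:
  assumes ps: "projective_system I le X p" and C: "closedin (projective_limit I le X p) C"
  shows "threads_in I le X p (\<lambda>i. hoare_map (X i) (\<lambda>x. x i) C) = C"
proof
  let ?L = "projective_limit I le X p"
  have "x i \<in> hoare_map (X i) (\<lambda>x. x i) C" if x: "x \<in> C" and i: "i \<in> I" for x i
  proof -
    have "(\<lambda>x. x i) ` C \<subseteq> topspace (X i)"
      using closedin_subset[OF C]
        continuous_map_image_subset_topspace[OF continuous_map_projective_limit_proj[OF i, of le X p]]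
      by blast
    from closure_of_subset[OF this] x show ?thesis unfolding hoare_map_def by blast
  qed
  then show "C \<subseteq> threads_in I le X p (\<lambda>i. hoare_map (X i) (\<lambda>x. x i) C)"
    using closedin_subset[OF C] unfolding threads_in_def by blast
  show "threads_in I le X p (\<lambda>i. hoare_map (X i) (\<lambda>x. x i) C) \<subseteq> C"
  proof
    fix x assume x: "x \<in> threads_in I le X p (\<lambda>i. hoare_map (X i) (\<lambda>x. x i) C)"
    then have xL: "x \<in> topspace ?L" by (simp add: threads_in_def)
    show "x \<in> C"
    proof (rule ccontr)
      assume "x \<notin> C"
      with xL have xV: "x \<in> topspace ?L - C" by simp
      have V: "openin ?L (topspace ?L - C)" using C by (simp add: closedin_def)
      obtain i U where iU: "i \<in> I" "openin (X i) U" "x i \<in> U"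
        and sub: "\<And>y. y \<in> topspace ?L \<Longrightarrow> y i \<in> U \<Longrightarrow> y \<in> topspace ?L - C"
        using projective_limit_basis[OF ps V xV] by metis
      have "x i \<in> hoare_map (X i) (\<lambda>x. x i) C" using x iU(1) by (simp add: threads_in_def)
      then obtain y where "y \<in> C" "y i \<in> U"
        using hoare_map_meets[OF iU(2), of "\<lambda>x. x i" C] iU(3) by blast
      then show False using sub[of y] closedin_subset[OF C] by blast
    qed
  qed
qed

lemma closedin_threads_in:
  assumes "\<And>i. i \<in> I \<Longrightarrow> closedin (X i) (C i)"
  shows "closedin (projective_limit I le X p) (threads_in I le X p C)"
proof -
  let ?L = "projective_limit I le X p"
  have "threads_in I le X p C = topspace ?L \<inter> (\<Inter>i\<in>I. {x \<in> topspace ?L. x i \<in> C i})"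
    by (auto simp: threads_in_def)
  moreover have "closedin ?L {x \<in> topspace ?L. x i \<in> C i}" if "i \<in> I" for i
    by (rule closedin_continuous_map_preimage[where f = "\<lambda>x. x i"])
      (rule continuous_map_projective_limit_proj assms that)+
  ultimately show ?thesis
    by (cases "I = {}") (auto intro!: closedin_Inter closedin_Int)
qed

lemma hoare_map_threads_in:
  assumes ps: "projective_system I le X p" and dense: "has_dense_threads I le X p"
    and C: "coherent_closed_family I le X p C" and i: "i \<in> I"
  shows "hoare_map (X i) (\<lambda>x. x i) (threads_in I le X p C) = C i"
  unfolding hoare_map_def
proof (rule antisym)
  show "X i closure_of (\<lambda>x. x i) ` threads_in I le X p C \<subseteq> C i"
    using coherent_closed_family_closedin[OF ps C i] i
    by (intro closure_of_minimal) (auto simp: threads_in_def)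
  show "C i \<subseteq> X i closure_of (\<lambda>x. x i) ` threads_in I le X p C"
  proof
    fix z assume z: "z \<in> C i"
    have "\<exists>y\<in>(\<lambda>x. x i) ` threads_in I le X p C. y \<in> U" if "z \<in> U" "openin (X i) U" for U
      using dense C i z that unfolding has_dense_threads_def by blast
    moreover have "z \<in> topspace (X i)" using coherent_closed_family_topspace[OF ps C i] z by blast
    ultimately show "z \<in> X i closure_of (\<lambda>x. x i) ` threads_in I le X p C"
      by (simp add: in_closure_of)
  qed
qed

lemma hyperspace_limit_coherent:
  assumes "C \<in> topspace (projective_limit I le (\<lambda>i. hyperspace b (X i)) (\<lambda>i j. hoare_map (X i) (p i j)))"
  shows "coherent_closed_family I le X p C"
  using assms unfolding topspace_projective_limit coherent_closed_family_def
  by (auto simp: hoare_map_def closed_sets_def)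

text \<open>The inverse of the comparison map sends a coherent family to its threads. Both composites are
  identities by \<open>threads_in_hoare_map_eq\<close> and \<open>hoare_map_threads_in\<close>; the latter also shows that the
  threads of a family of non-empty sets form a non-empty set.\<close>

lemma is_projective_limit_hyperspace:
  assumes ps: "projective_system I le X p" and dense: "has_dense_threads I le X p"
  shows "is_projective_limit I le (\<lambda>i. hyperspace b (X i)) (\<lambda>i j. hoare_map (X i) (p i j))
           (hyperspace b (projective_limit I le X p)) (\<lambda>i. hoare_map (X i) (\<lambda>x. x i))"
proof -
  let ?L = "projective_limit I le X p"
  let ?HL = "projective_limit I le (\<lambda>i. hyperspace b (X i)) (\<lambda>i j. hoare_map (X i) (p i j))"
  let ?f = "\<lambda>C. \<lambda>i\<in>I. hoare_map (X i) (\<lambda>x. x i) C"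
  let ?g = "threads_in I le X p"
  note dir = projective_system_directed[OF ps]
  have f_limit: "?f C \<in> topspace ?HL" if C: "C \<in> closed_sets b ?L" for C
  proof -
    have CL: "C \<subseteq> topspace ?L" using C closedin_subset by (auto simp: closed_sets_def)
    have "hoare_map (X i) (p i j) (hoare_map (X j) (\<lambda>x. x j) C) = hoare_map (X i) (\<lambda>x. x i) C"
      if ij: "i \<in> I" "j \<in> I" "le i j" for i j
    proof -
      have "hoare_map (X i) (p i j) (hoare_map (X j) (\<lambda>x. x j) C) = hoare_map (X i) (\<lambda>x. p i j (x j)) C"
        by (rule hoare_map_comp[OF continuous_map_projective_limit_proj[OF ij(2)]
              projective_system_continuous[OF ps ij] CL])
      also have "\<dots> = hoare_map (X i) (\<lambda>x. x i) C"
      proof (rule hoare_map_cong)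
        fix x assume "x \<in> C"
        then have "x \<in> topspace ?L" using CL by blast
        then show "p i j (x j) = x i" using ij unfolding topspace_projective_limit by blast
      qed
      finally show ?thesis .
    qed
    moreover have "hoare_map (X i) (\<lambda>x. x i) C \<in> closed_sets b (X i)" if "i \<in> I" for i
      by (rule hoare_map_in_closed_sets[OF continuous_map_projective_limit_proj[OF that] C])
    ultimately show ?thesis
      by (simp add: topspace_projective_limit)
  qed
  have f: "continuous_map (hyperspace b ?L) ?HL ?f"
    unfolding projective_limit_def[of I le "\<lambda>i. hyperspace b (X i)"] continuous_map_in_subtopology
  proof
    show "continuous_map (hyperspace b ?L) (product_topology (\<lambda>i. hyperspace b (X i)) I) ?f"
      unfolding continuous_map_componentwise
    proof (intro conjI ballI)
      show "continuous_map (hyperspace b ?L) (hyperspace b (X i)) (\<lambda>C. ?f C i)" if "i \<in> I" for i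
        using continuous_map_hoare_map[OF continuous_map_projective_limit_proj[OF that]] that by simp
    qed auto
    show "?f \<in> topspace (hyperspace b ?L) \<rightarrow>
        {x \<in> \<Pi>\<^sub>E i\<in>I. topspace (hyperspace b (X i)). \<forall>i\<in>I. \<forall>j\<in>I. le i j \<longrightarrow> hoare_map (X i) (p i j) (x j) = x i}"
      using f_limit unfolding topspace_projective_limit topspace_hyperspace by blast
  qed
  have g_closed: "?g C \<in> closed_sets b ?L" if C: "C \<in> topspace ?HL" for C
  proof -
    have coh: "coherent_closed_family I le X p C" by (rule hyperspace_limit_coherent[OF C])
    have "closedin ?L (?g C)"
      using closedin_threads_in coherent_closed_family_closedin[OF ps coh] .
    moreover have "?g C \<noteq> {}" if "\<not> b"
    proof -
      obtain i where i: "i \<in> I" using directed_preorder_nonempty[OF dir] by blast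
      have "C i \<in> closed_sets b (X i)"
        using C i by (auto simp: topspace_projective_limit)
      then have "C i \<noteq> {}" using that by (simp add: closed_sets_def)
      then show ?thesis
        using hoare_map_threads_in[OF ps dense coh i] by (auto simp: hoare_map_def)
    qed
    ultimately show ?thesis by (auto simp: closed_sets_def)
  qed
  have g: "continuous_map ?HL (hyperspace b ?L) ?g"
    unfolding hyperspace_def[of b ?L]
  proof (rule continuous_map_into_lower_vietoris)
    show "?g C \<in> closed_sets b ?L" if "C \<in> topspace ?HL" for C by (rule g_closed[OF that])
    fix V assume V: "openin ?L V"
    \<comment> \<open>\<open>V\<close> is the union of the basic open sets inside it. Density of threads says that \<open>?g C\<close> meets the
      basic open set of \<open>i\<close> and \<open>U\<close> as soon as \<open>C i\<close> meets \<open>U\<close>, a condition on one coordinate of \<open>C\<close>.\<close>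
    let ?inside = "\<lambda>i U. i \<in> I \<and> openin (X i) U \<and> (\<forall>y\<in>topspace ?L. y i \<in> U \<longrightarrow> y \<in> V)"
    let ?D = "\<lambda>i U. {C \<in> topspace ?HL. C i \<in> {A \<in> closed_sets b (X i). A \<inter> U \<noteq> {}}}"
    have "{C \<in> topspace ?HL. ?g C \<inter> V \<noteq> {}} = \<Union>{?D i U | i U. ?inside i U}"
    proof (intro set_eqI iffI)
      fix C assume C: "C \<in> {C \<in> topspace ?HL. ?g C \<inter> V \<noteq> {}}"
      then obtain x where x: "x \<in> ?g C" "x \<in> V" by blast
      obtain i U where iU: "i \<in> I" "openin (X i) U" "x i \<in> U"
        and sub: "\<And>y. y \<in> topspace ?L \<Longrightarrow> y i \<in> U \<Longrightarrow> y \<in> V"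
        using projective_limit_basis[OF ps V x(2)] by metis
      have "C i \<in> closed_sets b (X i)"
        using C iU(1) by (auto simp: topspace_projective_limit)
      moreover have "x i \<in> C i" using x(1) iU(1) by (simp add: threads_in_def)
      ultimately have "C \<in> ?D i U" using C iU(3) by blast
      moreover have "?inside i U" using iU sub by blast
      ultimately show "C \<in> \<Union>{?D i U | i U. ?inside i U}" by blast
    next
      fix C assume "C \<in> \<Union>{?D i U | i U. ?inside i U}"
      then obtain i U where iU: "?inside i U" and C: "C \<in> topspace ?HL" "C i \<inter> U \<noteq> {}" by blast
      obtain x where x: "x \<in> ?g C" "x i \<in> U"
        using dense hyperspace_limit_coherent[OF C(1)] iU C(2) unfolding has_dense_threads_def by blast
      then have "x \<in> V" using iU by (simp add: threads_in_def)
      then show "C \<in> {C \<in> topspace ?HL. ?g C \<inter> V \<noteq> {}}" using x(1) C(1) by blast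
    qed
    moreover have "openin ?HL (?D i U)" if "?inside i U" for i U
    proof (rule openin_continuous_map_preimage[where f = "\<lambda>C. C i"])
      show "continuous_map ?HL (hyperspace b (X i)) (\<lambda>C. C i)"
        using that by (intro continuous_map_projective_limit_proj) blast
      show "openin (hyperspace b (X i)) {A \<in> closed_sets b (X i). A \<inter> U \<noteq> {}}"
        unfolding hyperspace_def using openin_lower_vietoris_diamond that by blast
    qed
    then have "openin ?HL (\<Union>{?D i U | i U. ?inside i U})"
      by (intro openin_Union) blast
    ultimately show "openin ?HL {C \<in> topspace ?HL. ?g C \<inter> V \<noteq> {}}" by (simp only:)
  qed
  have gf: "?g (?f C) = C" if "C \<in> topspace (hyperspace b ?L)" for C
  proof -
    have "?g (?f C) = ?g (\<lambda>i. hoare_map (X i) (\<lambda>x. x i) C)" by (simp add: threads_in_def)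
    then show ?thesis using threads_in_hoare_map_eq[OF ps] that by (simp add: closed_sets_def)
  qed
  have fg: "?f (?g C) = C" if C: "C \<in> topspace ?HL" for C
  proof (rule PiE_ext)
    show "?f (?g C) \<in> (\<Pi>\<^sub>E i\<in>I. UNIV)" by simp
    show "C \<in> (\<Pi>\<^sub>E i\<in>I. UNIV)" using C by (auto simp: topspace_projective_limit)
    show "?f (?g C) i = C i" if "i \<in> I" for i
      using hoare_map_threads_in[OF ps dense hyperspace_limit_coherent[OF C] that] that by simp
  qed
  have "homeomorphic_maps (hyperspace b ?L) ?HL ?f ?g"
    unfolding homeomorphic_maps_def using f g gf fg by blast
  then show ?thesis
    unfolding is_projective_limit_def homeomorphic_map_maps by blast
qed

theorem theorem7p5:
  fixes I :: "'i set"
    and le :: "'i \<Rightarrow> 'i \<Rightarrow> bool"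
    and X :: "'i \<Rightarrow> 'a topology"
    and p :: "'i \<Rightarrow> 'i \<Rightarrow> 'a \<Rightarrow> 'a"
  assumes "projective_system I le X p"
    and "ep_system I le X p
       \<or> ((\<forall>i\<in>I. sober_space (X i)) \<and>
          (\<forall>i\<in>I. \<forall>j\<in>I. le i j \<longrightarrow> saturated_proper_map (X j) (X i) (p i j)))
       \<or> (has_countable_cofinal I le \<and>
          (\<forall>i\<in>I. base_locally_compact_space (X i) \<and> sober_space (X i)))"
  shows "(projective_system I le (\<lambda>i. hoare_space (X i)) (\<lambda>i j. hoare_map (X i) (p i j)) \<and>
          is_projective_limit I le (\<lambda>i. hoare_space (X i)) (\<lambda>i j. hoare_map (X i) (p i j))
            (hoare_space (projective_limit I le X p)) (\<lambda>i. hoare_map (X i) (\<lambda>x. x i))) \<and>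
         (projective_system I le (\<lambda>i. hoare0_space (X i)) (\<lambda>i j. hoare_map (X i) (p i j)) \<and>
          is_projective_limit I le (\<lambda>i. hoare0_space (X i)) (\<lambda>i j. hoare_map (X i) (p i j))
            (hoare0_space (projective_limit I le X p)) (\<lambda>i. hoare_map (X i) (\<lambda>x. x i)))"
proof -
  have "has_dense_threads I le X p"
    using assms(2)
  proof (elim disjE)
    show "has_dense_threads I le X p" if "ep_system I le X p"
      by (rule ep_system_dense_threads[OF that])
    show "has_dense_threads I le X p"
      if "(\<forall>i\<in>I. sober_space (X i)) \<and>
          (\<forall>i\<in>I. \<forall>j\<in>I. le i j \<longrightarrow> saturated_proper_map (X j) (X i) (p i j))"
      using that by (intro proper_sober_dense_threads[OF assms(1)]) simp_all
    show "has_dense_threads I le X p"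
      if "has_countable_cofinal I le \<and> (\<forall>i\<in>I. base_locally_compact_space (X i) \<and> sober_space (X i))"
      using that by (intro locally_compact_sober_dense_threads[OF assms(1)]) simp_all
  qed
  then show ?thesis
    unfolding hoare_space_eq_hyperspace hoare0_space_eq_hyperspace
    using projective_system_hyperspace[OF assms(1)] is_projective_limit_hyperspace[OF assms(1)]
    by blast
qed

end
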